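(* Assume $\mathcal H$ is finite dimensional. Then for all initial data $x_0,v_0\in\mathcal H$ there exists a trajectory solution $x:[t_0,\infty)\to\mathcal H$ of (MTRIGS).
   Context: $\mathcal H$ real Hilbert space; $f_1,\dots,f_m:\mathcal H\to\mathbb R$ convex, continuously differentiable with Lipschitz continuous gradients. Parameters $t_0>0$, $\alpha,\beta>0$, $q\in(0,1]$, $p\in(0,2]$. $C(x):=\operatorname{conv}\{\nabla f_1(x),\dots,\nabla f_m(x)\}$; $\operatorname{proj}_K(y)$ is the nearest point to $y$ in a nonempty closed convex $K$. A trajectory solution of (MTRIGS) with data $(x_0,v_0)$ is $x:[t_0,\infty)\to\mathcal H$ such that: $x$ is continuously differentiable; $\dot x$ is absolutely continuous on $[t_0,T]$ for every $T\ge t_0$; there is a Bochner measurable $\ddot x:[t_0,\infty)\to\mathcal H$ with $\dot x(t)=\dot x(t_0)+\int_{t_0}^t\ddot x(s)\,ds$ for all $t$, and $\frac{d}{dt}\dot x(t)=\ddot x(t)$ a.e.; for almost every $t\ge t_0$, $\frac{\alpha}{t^q}\dot x(t)+\operatorname{proj}_{C(x(t))+\frac{\beta}{t^p}x(t)+\ddot x(t)}(0)=0$; and $x(t_0)=x_0$, $\dot x(t_0)=v_0$. *)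

theory Defs
  imports "HOL-Analysis.Analysis"
begin

definition abs_continuous_on :: "real \<Rightarrow> real \<Rightarrow> (real \<Rightarrow> 'a::real_normed_vector) \<Rightarrow> bool" where
  "abs_continuous_on a b g \<longleftrightarrow>
    (\<forall>\<epsilon>>0. \<exists>\<delta>>0. \<forall>(n::nat) (s::nat \<Rightarrow> real) (t::nat \<Rightarrow> real).
       (\<forall>k<n. a \<le> s k \<and> s k \<le> t k \<and> t k \<le> b) \<and>
       (\<forall>k<n. \<forall>l<n. k \<noteq> l \<longrightarrow> t k \<le> s l \<or> t l \<le> s k) \<and>
       (\<Sum>k<n. t k - s k) < \<delta>
       \<longrightarrow> (\<Sum>k<n. norm (g (t k) - g (s k))) < \<epsilon>)"

definition Cset :: "nat \<Rightarrow> (nat \<Rightarrow> 'a::real_vector \<Rightarrow> 'a) \<Rightarrow> 'a \<Rightarrow> 'a set" where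
  "Cset m g y = convex hull ((\<lambda>i. g i y) ` {1..m})"

text \<open>Projection onto a nonempty closed convex set = nearest point (library closest_point).
  A trajectory solution of (MTRIGS) with data (x0, v0); g i is the gradient of f_i.\<close>
definition MTRIGS_solution ::
  "nat \<Rightarrow> (nat \<Rightarrow> 'a::euclidean_space \<Rightarrow> 'a) \<Rightarrow> real \<Rightarrow> real \<Rightarrow> real \<Rightarrow> real \<Rightarrow> real
    \<Rightarrow> 'a \<Rightarrow> 'a \<Rightarrow> (real \<Rightarrow> 'a) \<Rightarrow> bool" where
  "MTRIGS_solution m g \<alpha> \<beta> q p t0 x0 v0 x \<longleftrightarrow>
    (\<exists>xd xdd.
      (\<forall>t\<ge>t0. (x has_vector_derivative xd t) (at t within {t0..})) \<and>
      continuous_on {t0..} xd \<and>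
      (\<forall>T\<ge>t0. abs_continuous_on t0 T xd) \<and>
      xdd \<in> borel_measurable (restrict_space lborel {t0..}) \<and>
      (\<forall>t\<ge>t0. set_integrable lborel {t0..t} xdd \<and>
                xd t = xd t0 + (LINT s:{t0..t}|lborel. xdd s)) \<and>
      (AE t in lborel. t \<ge> t0 \<longrightarrow> (xd has_vector_derivative xdd t) (at t within {t0..})) \<and>
      (AE t in lborel. t \<ge> t0 \<longrightarrow>
         (\<alpha> / t powr q) *\<^sub>R xd t
         + closest_point ((\<lambda>c. c + (\<beta> / t powr p) *\<^sub>R x t + xdd t) ` Cset m g (x t)) 0 = 0) \<and>
      x t0 = x0 \<and> xd t0 = v0)"

end

theory Submission
  imports Defs "HOL-Complex_Analysis.Great_Picard"
begin

text \<open>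
  By the variational characterisation of the projection, the differential condition says
  \<open>x'' = - \<gamma> x' - \<omega> x - d\<close> for some \<open>d \<in> C(x)\<close> maximising \<open>\<langle>x', d\<rangle>\<close> over \<open>C(x)\<close>, where
  \<open>\<gamma>(t) = \<alpha> / t\<^sup>q\<close> and \<open>\<omega>(t) = \<beta> / t\<^sup>p\<close>. This is a differential inclusion whose right-hand side is
  upper semicontinuous, convex- and compact-valued and of linear growth. A discontinuous selection
  of it is followed by the Euler scheme; a subsequence converges pointwise to a locally Lipschitz
  limit. Difference quotients of Euler iterates are convex combinations of nearby values of the
  selection, so the derivative of the limit lies in the right-hand side wherever it exists, and no weak
  compactness is needed. It exists almost everywhere and integrates back to the function
  because Lipschitz functions are almost everywhere differentiable, which comes from the Vitali
  covering theorem.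
\<close>

section \<open>Differentiability of Lipschitz functions\<close>

lemma emeasure_interval_measure_Ioo:
  assumes mono: "\<And>s t. s \<le> t \<Longrightarrow> F s \<le> F t" and cont: "continuous_on UNIV F" and "a \<le> b"
  shows "emeasure (interval_measure F) {a<..<b} = ennreal (F b - F a)"
proof -
  let ?M = "interval_measure F"
  have null: "emeasure ?M {c} = 0" for c
    using emeasure_interval_measure_Icc[of c c F] mono cont by simp
  have "emeasure ?M {a<..<b} = emeasure ?M ({a..b} - {a} - {b})"
    by (rule arg_cong[where f="emeasure ?M"]) auto
  also have "\<dots> = emeasure ?M {a..b}"
    using null by (simp add: emeasure_Diff_null_set null_sets_def)
  also have "\<dots> = ennreal (F b - F a)"
    by (rule emeasure_interval_measure_Icc) (use assms in auto)
  finally show ?thesis .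
qed

text \<open>The function \<open>L * t - u t\<close> is again monotone, and the increments of the two
  functions over an interval add up to \<open>L\<close> times its length. The measures therefore
  agree on open intervals, which determine Lebesgue measure. Lower bounds for slopes of
  \<open>u\<close> thus become upper bounds for slopes of the complementary function, and one
  covering argument serves both.\<close>

lemma interval_measure_add_complement:
  fixes u :: "real \<Rightarrow> real"
  assumes mono: "\<And>s t. s \<le> t \<Longrightarrow> u s \<le> u t"
    and lip: "\<And>s t. s \<le> t \<Longrightarrow> u t - u s \<le> L * (t - s)"
    and cont: "continuous_on UNIV u" and "L > 0" and A: "A \<in> sets borel"
  shows "emeasure (interval_measure u) A + emeasure (interval_measure (\<lambda>t. L * t - u t)) A
           = ennreal L * emeasure lborel A"
proof -
  let ?M = "interval_measure u" and ?M' = "interval_measure (\<lambda>t. L * t - u t)"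
  \<comment> \<open>The factor \<open>1 / L\<close> gives every open interval its length as mass, so
    that \<open>lborel_eqI\<close> identifies \<open>N\<close> with Lebesgue measure.\<close>
  define N where
    "N = measure_of UNIV (sets borel) (\<lambda>A. ennreal (1 / L) * (emeasure ?M A + emeasure ?M' A))"
  have setsN: "sets N = sets borel"
    by (simp add: N_def sigma_algebra.sigma_sets_eq[OF sets.sigma_algebra_axioms[of borel, simplified]])
  have em: "emeasure N B = ennreal (1 / L) * (emeasure ?M B + emeasure ?M' B)"
    if "B \<in> sets borel" for B
  proof (rule emeasure_measure_of[OF N_def])
    show "countably_additive (sets N)
            (\<lambda>A. ennreal (1 / L) * (emeasure ?M A + emeasure ?M' A))"
      unfolding countably_additive_def setsN
      by (auto simp: ennreal_suminf_cmult suminf_add[symmetric] suminf_emeasure)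
  qed (use that in \<open>auto simp: setsN positive_def\<close>)
  have mono': "L * s - u s \<le> L * t - u t" if "s \<le> t" for s t
    using lip[OF that] by (simp add: algebra_simps)
  have cont': "continuous_on UNIV (\<lambda>t. L * t - u t)"
    by (intro continuous_intros cont)
  have "lborel = N"
  proof (rule lborel_eqI)
    fix l v :: real assume "\<And>b. b \<in> Basis \<Longrightarrow> l \<bullet> b \<le> v \<bullet> b"
    then have lv: "l \<le> v" by simp
    have "emeasure N {l<..<v}
        = ennreal (1 / L) * (ennreal (u v - u l) + ennreal (L * v - u v - (L * l - u l)))"
      using mono mono' cont cont' lv by (subst em) (simp_all add: emeasure_interval_measure_Ioo)
    also have "\<dots> = ennreal (1 / L * ((u v - u l) + (L * v - u v - (L * l - u l))))"
      using mono[OF lv] mono'[OF lv] \<open>L > 0\<close>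
      by (subst ennreal_plus[symmetric]) (auto simp flip: ennreal_mult')
    also have "1 / L * ((u v - u l) + (L * v - u v - (L * l - u l))) = v - l"
      using \<open>L > 0\<close> by (simp add: field_simps)
    finally show "emeasure N (box l v) = (\<Prod>b\<in>Basis. (v - l) \<bullet> b)"
      by (simp add: box_real)
  qed (simp add: setsN)
  then have "ennreal L * emeasure lborel A
      = ennreal L * (ennreal (1 / L) * (emeasure ?M A + emeasure ?M' A))"
    using em[OF A] by simp
  also have "\<dots> = ennreal (L * (1 / L)) * (emeasure ?M A + emeasure ?M' A)"
    using \<open>L > 0\<close> by (subst ennreal_mult) (auto simp: mult.assoc)
  finally show ?thesis using \<open>L > 0\<close> by simp
qed

text \<open>Enclose \<open>E\<close> in an open \<open>U\<close> of almost the same measure. By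
  Vitali, disjoint intervals inside \<open>U\<close> of slope at least \<open>q\<close> cover almost
  all of \<open>E\<close>. Summing \<open>q * (b - a) \<le> u b - u a\<close> over them compares
  \<open>q\<close> times the measure of \<open>E\<close> with the Stieltjes mass of
  \<open>U\<close>, which exceeds that of \<open>E\<close> by little because \<open>u\<close> is
  Lipschitz.\<close>

lemma slope_bound_measure:
  fixes u :: "real \<Rightarrow> real"
  assumes mono: "\<And>s t. s \<le> t \<Longrightarrow> u s \<le> u t"
    and lip: "\<And>s t. s \<le> t \<Longrightarrow> u t - u s \<le> L * (t - s)"
    and cont: "continuous_on UNIV u" and L: "L > 0"
    and E: "E \<in> sets borel" and bnd: "bounded E"
    and slope: "\<And>x d. x \<in> E \<Longrightarrow> 0 < d \<Longrightarrow>
            \<exists>a b. a < x \<and> x < b \<and> b - a < d \<and> q * (b - a) \<le> u b - u a"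
  shows "q * measure lborel E \<le> measure (interval_measure u) E"
\<comment> \<open>Negative \<open>q\<close> is trivial, and is split off because
  \<open>ennreal\<close> truncates negative numbers to 0.\<close>
proof (cases "q \<ge> 0")
  case False
  then show ?thesis
    by (meson linorder_not_le measure_nonneg mult_nonneg_nonpos2 order.strict_implies_order order_trans split_mult_neg_le)
next
  case q: True
  let ?M = "interval_measure u"
  have le: "emeasure ?M A \<le> ennreal L * emeasure lborel A" if "A \<in> sets borel" for A
    using interval_measure_add_complement[OF mono lip cont L that]
    by (metis le_iff_add)
  have finE: "emeasure lborel E < \<infinity>"
    using emeasure_bounded_finite[OF bnd] by simp
  have finME: "emeasure ?M E < \<infinity>"
    using le[OF E] finE by (metis ennreal_less_top ennreal_mult_less_top infinity_ennreal_def order_le_less_trans)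
  have key: "ennreal q * emeasure lborel E \<le> emeasure ?M E + ennreal L * ennreal e" if "e > 0" for e
  proof -
    obtain U where U: "open U" "E \<subseteq> U" "emeasure lebesgue (U - E) < ennreal e"
      using sets_lebesgue_outer_open[of E e] E \<open>e > 0\<close> by auto
    define K where "K = {(a, b). a < b \<and> {a..b} \<subseteq> U \<and> q * (b - a) \<le> u b - u a}"
    \<comment> \<open>The covering theorem speaks of closed balls, so an interval indexed by its
      endpoints is written with midpoint and half-length.\<close>
    have cb: "cball ((a + b) / 2) ((b - a) / 2) = {a..b}" if "a < b" for a b :: real
      by (auto simp: cball_eq_atLeastAtMost field_simps)
    obtain C where C: "countable C" "C \<subseteq> K"
      "pairwise (\<lambda>i j. disjnt (cball ((fst i + snd i) / 2) ((snd i - fst i) / 2))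
          (cball ((fst j + snd j) / 2) ((snd j - fst j) / 2))) C"
      "negligible (E - (\<Union>i\<in>C. cball ((fst i + snd i) / 2) ((snd i - fst i) / 2)))"
    proof (rule Vitali_covering_theorem_cballs
        [of K "\<lambda>i. (snd i - fst i) / 2" E "\<lambda>i. (fst i + snd i) / 2"])
      show "0 < (snd i - fst i) / 2" if "i \<in> K" for i
        using that by (auto simp: K_def)
      fix x d :: real assume x: "x \<in> E" "0 < d"
      then obtain r where r: "r > 0" "ball x r \<subseteq> U"
        using U by (meson open_contains_ball subsetD)
      \<comment> \<open>Length below \<open>r\<close> keeps the interval inside
        \<open>ball x r\<close> and hence inside \<open>U\<close>; length below \<open>d\<close>
        makes the cover fine at \<open>x\<close>.\<close>
      obtain a b where ab: "a < x" "x < b" "b - a < min r d" "q * (b - a) \<le> u b - u a"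
        using slope[of x "min r d"] x r by auto
      have "{a..b} \<subseteq> ball x r" using ab by (auto simp: dist_real_def)
      then have "(a, b) \<in> K" using ab r by (auto simp: K_def)
      moreover have "x \<in> cball ((a + b) / 2) ((b - a) / 2)" using cb[of a b] ab by auto
      ultimately show "\<exists>i. i \<in> K \<and> x \<in> cball ((fst i + snd i) / 2) ((snd i - fst i) / 2) \<and> (snd i - fst i) / 2 < d"
        using ab by (intro exI[of _ "(a, b)"]) auto
    qed
    define I where "I i = {fst i..snd i}" for i :: "real \<times> real"
    have I: "cball ((fst i + snd i) / 2) ((snd i - fst i) / 2) = I i" if "i \<in> C" for i
      using that C(2) cb by (auto simp: K_def I_def)
    have Im: "I i \<in> sets borel" for i
      by (simp add: I_def)
    have disj: "disjoint_family_on I C"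
      using C(3) I by (auto simp: disjoint_family_on_def pairwise_def disjnt_def)
    define W where "W = (\<Union>i\<in>C. I i)"
    have W: "W \<in> sets borel"
      using C(1) by (auto simp: W_def I_def)
    have "I i \<subseteq> U" if "i \<in> C" for i
      using subsetD[OF C(2) that] by (cases i) (simp add: K_def I_def)
    then have WU: "W \<subseteq> U"
      by (auto simp: W_def)
    have neg: "negligible (E - W)"
      using C(4) I by (simp add: W_def)
    have "emeasure lborel E \<le> emeasure lborel W"
    proof -
      have "E - W \<in> null_sets lborel"
        using neg E W by (auto simp: negligible_iff_null_sets null_sets_def)
      then have "emeasure lborel (W \<union> (E - W)) = emeasure lborel W"
        using W by (intro emeasure_Un_null_set) auto
      moreover have "emeasure lborel E \<le> emeasure lborel (W \<union> (E - W))"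
        using E W by (intro emeasure_mono) auto
      ultimately show ?thesis by simp
    qed
    then have "ennreal q * emeasure lborel E \<le> ennreal q * emeasure lborel W"
      by (simp add: mult_left_mono)
    also have "emeasure lborel W = (\<integral>\<^sup>+i. emeasure lborel (I i) \<partial>count_space C)"
      unfolding W_def using C(1) disj by (intro emeasure_UN_countable) (simp_all add: Im)
    also have "ennreal q * \<dots> = (\<integral>\<^sup>+i. ennreal q * emeasure lborel (I i) \<partial>count_space C)"
      by (simp add: nn_integral_cmult)
    also have "\<dots> \<le> (\<integral>\<^sup>+i. emeasure ?M (I i) \<partial>count_space C)"
    proof (rule nn_integral_mono)
      fix i assume "i \<in> space (count_space C)"
      then have "i \<in> K" using C(2) by auto
      then have i: "fst i < snd i" "q * (snd i - fst i) \<le> u (snd i) - u (fst i)"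
        by (auto simp: K_def)
      then show "ennreal q * emeasure lborel (I i) \<le> emeasure ?M (I i)"
        using mono cont q
        by (simp add: I_def emeasure_interval_measure_Icc ennreal_mult'[symmetric] ennreal_leI)
    qed
    also have "\<dots> = emeasure ?M W"
      unfolding W_def using C(1) disj
      by (intro emeasure_UN_countable[symmetric]) (simp_all add: Im)
    \<comment> \<open>Passing from \<open>W\<close> to \<open>E\<close> costs at most the Stieltjes
      mass of \<open>U - E\<close>, which is at most \<open>L * e\<close> by domination.\<close>
    also have "\<dots> \<le> emeasure ?M (E \<union> (U - E))"
      using W WU U E by (intro emeasure_mono) auto
    also have "\<dots> \<le> emeasure ?M E + emeasure ?M (U - E)"
      using U E by (intro emeasure_subadditive) auto
    also have "emeasure ?M (U - E) \<le> ennreal L * emeasure lborel (U - E)"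
      using U E by (intro le) auto
    also have "emeasure lborel (U - E) \<le> ennreal e"
      using U E by (auto intro!: less_imp_le)
    finally show ?thesis by (simp add: add_left_mono mult_left_mono)
  qed
  have "q * measure lborel E \<le> measure ?M E + L * e" if "e > 0" for e
  proof -
    have "ennreal (q * measure lborel E) \<le> ennreal (measure ?M E + L * e)"
      using key[OF that] q L that finE finME
      by (simp add: emeasure_eq_ennreal_measure ennreal_mult' ennreal_plus less_top)
    then show ?thesis using L that by (simp add: ennreal_le_iff del: ennreal_plus)
  qed
  note * = this
  show ?thesis
  proof (rule field_le_epsilon)
    fix e :: real assume "e > 0"
    then show "q * measure lborel E \<le> measure ?M E + e"
      using *[of "e / L"] L by simp
  qed
qed

section \<open>Steep points, oscillation of slopes and differentiability\<close>

text \<open>Intervals containing \<open>x\<close> in their interior, and a strict inequality, make this a \<open>G\<^sub>\<delta>\<close> set.\<close>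
definition steep :: "(real \<Rightarrow> real) \<Rightarrow> real \<Rightarrow> real set" where
  "steep u q = {x. \<forall>d>0. \<exists>a b. a < x \<and> x < b \<and> b - a < d \<and> q * (b - a) < u b - u a}"

lemma borel_steep: "steep u q \<in> sets borel"
proof -
  have "steep u q = (\<Inter>n. \<Union>(a, b)\<in>{(a, b). b - a < 1 / real (Suc n) \<and> q * (b - a) < u b - u a}. {a<..<b})"
    (is "_ = (\<Inter>n. ?G n)")
  proof (intro set_eqI iffI)
    fix x assume "x \<in> steep u q"
    then have "\<exists>a b. a < x \<and> x < b \<and> b - a < 1 / real (Suc n) \<and> q * (b - a) < u b - u a" for n
      unfolding steep_def by (simp del: of_nat_Suc)
    then show "x \<in> (\<Inter>n. ?G n)"
      by fastforce
  next
    fix x assume x: "x \<in> (\<Inter>n. ?G n)"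
    show "x \<in> steep u q"
      unfolding steep_def
    proof safe
      fix d :: real assume "d > 0"
      then obtain n where "1 / real (Suc n) < d" using nat_approx_posE by blast
      moreover obtain a b where "a < x" "x < b" "b - a < 1 / real (Suc n)" "q * (b - a) < u b - u a"
        using x by fastforce
      ultimately show "\<exists>a b. a < x \<and> x < b \<and> b - a < d \<and> q * (b - a) < u b - u a"
        by (intro exI[of _ a] exI[of _ b]) linarith
    qed
  qed
  moreover have "open (?G n)" for n by auto
  ultimately show ?thesis by auto
qed

text \<open>The second set consists of the points with arbitrarily short intervals of slope below \<open>p\<close>.\<close>
lemma steep_oscillation_null:
  fixes u :: "real \<Rightarrow> real"
  assumes mono: "\<And>s t. s \<le> t \<Longrightarrow> u s \<le> u t"
    and lip: "\<And>s t. s \<le> t \<Longrightarrow> u t - u s \<le> L * (t - s)"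
    and cont: "continuous_on UNIV u" and L: "L > 0" and pq: "p < q"
  shows "steep u q \<inter> steep (\<lambda>t. L * t - u t) (L - p) \<in> null_sets lborel" (is "?S \<in> _")
proof -
  let ?M = "interval_measure u" and ?w = "\<lambda>t. L * t - u t"
  let ?M' = "interval_measure ?w"
  have S: "?S \<in> sets borel" by (intro sets.Int borel_steep)
  \<comment> \<open>Truncation gives a bounded set, so all measures involved are finite and can be
    compared as real numbers.\<close>
  have "?S \<inter> {-real n..real n} \<in> null_sets lborel" for n
  proof -
    define E where "E = ?S \<inter> {-real n..real n}"
    have E: "E \<in> sets borel" "bounded E" using S by (auto simp: E_def bounded_Int)
    have 1: "q * measure lborel E \<le> measure ?M E"
    proof (rule slope_bound_measure[OF mono lip cont L E])
      fix x d :: real assume "x \<in> E" "0 < d"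
      then show "\<exists>a b. a < x \<and> x < b \<and> b - a < d \<and> q * (b - a) \<le> u b - u a"
        unfolding E_def steep_def by (blast intro: less_imp_le)
    qed
    have 2: "(L - p) * measure lborel E \<le> measure ?M' E"
    proof (rule slope_bound_measure[OF _ _ _ L E])
      show "?w s \<le> ?w t" if "s \<le> t" for s t
        using lip[OF that] by (simp add: algebra_simps)
      show "?w t - ?w s \<le> L * (t - s)" if "s \<le> t" for s t
        using mono[OF that] by (simp add: algebra_simps)
      show "continuous_on UNIV ?w" by (intro continuous_intros cont)
      fix x d :: real assume "x \<in> E" "0 < d"
      then show "\<exists>a b. a < x \<and> x < b \<and> b - a < d \<and> (L - p) * (b - a) \<le> ?w b - ?w a"
        unfolding E_def steep_def by (blast intro: less_imp_le)
    qed
    have fin: "emeasure lborel E < \<infinity>" using emeasure_bounded_finite[OF E(2)] .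
    have sum: "emeasure ?M E + emeasure ?M' E = ennreal L * emeasure lborel E"
      by (rule interval_measure_add_complement[OF mono lip cont L E(1)])
    with fin have "emeasure ?M E + emeasure ?M' E < top"
      by (simp add: ennreal_mult_less_top)
    then have fin': "emeasure ?M E < top" "emeasure ?M' E < top"
      by (auto simp: ennreal_add_less_top)
    have "ennreal (measure ?M E + measure ?M' E) = ennreal (L * measure lborel E)"
      using sum fin fin' L by (simp add: emeasure_eq_ennreal_measure ennreal_mult' ennreal_plus less_top)
    then have "measure ?M E + measure ?M' E = L * measure lborel E"
      using L by (subst (asm) ennreal_inj) auto
    \<comment> \<open>Adding the two slope estimates gives
      \<open>(q + L - p) * measure lborel E \<le> L * measure lborel E\<close>.\<close>
    with 1 2 have "(q - p) * measure lborel E \<le> 0"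
      by (simp add: algebra_simps)
    with pq have "measure lborel E = 0"
      by (smt (verit) measure_nonneg mult_pos_pos)
    with fin E(1) show ?thesis
      by (auto simp: E_def[symmetric] null_sets_def emeasure_eq_ennreal_measure less_top)
  qed
  then have "(\<Union>n. ?S \<inter> {-real n..real n}) \<in> null_sets lborel"
    by (intro null_sets_UN) auto
  also have "(\<Union>n. ?S \<inter> {-real n..real n}) = ?S"
  proof -
    have "\<exists>n. x \<in> {-real n..real n}" for x :: real
    proof -
      obtain n where "\<bar>x\<bar> \<le> real n" using real_arch_simple by blast
      then show ?thesis by (intro exI[of _ n]) auto
    qed
    then show ?thesis by blast
  qed
  finally show ?thesis .
qed

text \<open>In \<open>steep\<close> the point is interior to the intervals, whereas a derivative
  needs intervals ending at \<open>x\<close>. Widening \<open>{a..b}\<close> by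
  \<open>1 / Suc n\<close> on both sides makes \<open>x\<close> interior, keeps the length below
  \<open>d\<close> for large \<open>n\<close>, and continuity carries the bound to the
  limit.\<close>

lemma slope_le_of_not_steep:
  fixes u :: "real \<Rightarrow> real"
  assumes cont: "continuous_on UNIV u" and "x \<notin> steep u q"
  shows "\<exists>d>0. \<forall>a b. a \<le> x \<and> x \<le> b \<and> b - a < d \<longrightarrow> u b - u a \<le> q * (b - a)"
proof -
  obtain d where d: "d > 0"
      "\<And>a b. a < x \<Longrightarrow> x < b \<Longrightarrow> b - a < d \<Longrightarrow> u b - u a \<le> q * (b - a)"
    using assms(2) unfolding steep_def mem_Collect_eq not_all not_imp not_ex de_Morgan_conj not_less
    by (meson linorder_not_le)
  have isc: "isCont u y" for y
    using cont by (simp add: continuous_on_eq_continuous_at)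
  have "u b - u a \<le> q * (b - a)" if "a \<le> x" "x \<le> b" "b - a < d" for a b
  proof -
    let ?e = "\<lambda>n. 1 / real (Suc n)"
    have e: "?e \<longlonglongrightarrow> 0" using LIMSEQ_inverse_real_of_nat by (simp add: inverse_eq_divide)
    have "(\<lambda>n. u (b + ?e n) - u (a - ?e n)) \<longlonglongrightarrow> u (b + 0) - u (a - 0)"
      by (intro tendsto_intros isCont_tendsto_compose[OF isc] e)
    moreover have "(\<lambda>n. q * ((b + ?e n) - (a - ?e n))) \<longlonglongrightarrow> q * ((b + 0) - (a - 0))"
      by (intro tendsto_intros e)
    moreover have "eventually (\<lambda>n. ?e n < (d - (b - a)) / 2) sequentially"
      using order_tendstoD(2)[OF e, of "(d - (b - a)) / 2"] that by simp
    then have "eventually (\<lambda>n. u (b + ?e n) - u (a - ?e n) \<le> q * ((b + ?e n) - (a - ?e n))) sequentially"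
    proof eventually_elim
      case (elim n)
      define \<eta> where "\<eta> = ?e n"
      have "\<eta> > 0" "\<eta> < (d - (b - a)) / 2" using elim by (simp_all add: \<eta>_def)
      then show ?case unfolding \<eta>_def[symmetric] using that by (intro d) (simp_all add: field_simps)
    qed
    ultimately have "u (b + 0) - u (a - 0) \<le> q * ((b + 0) - (a - 0))"
      by (intro tendsto_le[OF sequentially_bot])
    then show ?thesis by simp
  qed
  with d show ?thesis by blast
qed

text \<open>The derivative is the supremum \<open>D\<close> of all \<open>q\<close> for which
  \<open>x\<close> is steep. Above \<open>D\<close> the point is not steep, which bounds short
  slopes from above. Below \<open>D\<close> it is steep, so the hypothesis forbids steepness for the
  complementary function, which bounds short slopes from below.\<close>

lemma differentiable_outside_oscillation:
  fixes u :: "real \<Rightarrow> real"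
  assumes mono: "\<And>s t. s \<le> t \<Longrightarrow> u s \<le> u t"
    and lip: "\<And>s t. s \<le> t \<Longrightarrow> u t - u s \<le> L * (t - s)"
    and cont: "continuous_on UNIV u" and L: "L > 0"
    and x: "\<And>p q. p \<in> \<rat> \<Longrightarrow> q \<in> \<rat> \<Longrightarrow> p < q \<Longrightarrow>
              x \<notin> steep u q \<or> x \<notin> steep (\<lambda>t. L * t - u t) (L - p)"
  shows "\<exists>D. (u has_vector_derivative D) (at x)"
proof -
  let ?w = "\<lambda>t. L * t - u t"
  have contw: "continuous_on UNIV ?w" by (intro continuous_intros cont)
  define U where "U = {q. x \<in> steep u q}"
  have down: "q' \<in> U" if q: "q \<in> U" "q' \<le> q" for q q'
    unfolding U_def steep_def
  proof safe
    fix d :: real assume "d > 0"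
    then obtain a b where ab: "a < x" "x < b" "b - a < d" "q * (b - a) < u b - u a"
      using q(1) unfolding U_def steep_def by blast
    moreover have "q' * (b - a) \<le> q * (b - a)" using ab q by (intro mult_right_mono) auto
    ultimately show "\<exists>a b. a < x \<and> x < b \<and> b - a < d \<and> q' * (b - a) < u b - u a"
      by (meson order_le_less_trans)
  qed
  \<comment> \<open>Slopes of a monotone function exceed -1, so \<open>U\<close> is nonempty and its
    supremum is meaningful.\<close>
  have neg: "-1 \<in> U"
    unfolding U_def steep_def
  proof safe
    fix d :: real assume "d > 0"
    then show "\<exists>a b. a < x \<and> x < b \<and> b - a < d \<and> -1 * (b - a) < u b - u a"
      using mono[of "x - d/4" "x + d/4"] by (intro exI[of _ "x - d/4"] exI[of _ "x + d/4"]) auto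
  qed
  have upper: "q \<le> L" if q: "q \<in> U" for q
  proof -
    obtain a b where ab: "a < x" "x < b" "q * (b - a) < u b - u a"
      using q zero_less_one unfolding U_def steep_def mem_Collect_eq by meson
    then have "q * (b - a) < L * (b - a)" using lip[of a b] by linarith
    then show ?thesis using ab by (simp add: mult_less_cancel_right)
  qed
  have bdd: "bdd_above U" using upper by (auto simp: bdd_above_def)
  define D where "D = Sup U"
  have hi: "\<exists>d>0. \<forall>a b. a \<le> x \<and> x \<le> b \<and> b - a < d \<longrightarrow> u b - u a \<le> q * (b - a)" if "D < q" for q
  proof (rule slope_le_of_not_steep[OF cont])
    show "x \<notin> steep u q"
      using that cSup_upper[OF _ bdd, of q] by (auto simp: U_def D_def)
  qed
  have lo: "\<exists>d>0. \<forall>a b. a \<le> x \<and> x \<le> b \<and> b - a < d \<longrightarrow> p * (b - a) \<le> u b - u a" if p: "p < D" for p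
  proof -
    obtain q where q: "q \<in> U" "p < q"
      using p less_cSup_iff[OF _ bdd, of p] neg unfolding D_def by blast
    \<comment> \<open>The hypothesis concerns rational pairs only, hence two rationals are inserted
      between \<open>p\<close> and \<open>q\<close>.\<close>
    obtain p1 where p1: "p1 \<in> \<rat>" "p < p1" "p1 < q" using Rats_dense_in_real[OF q(2)] by blast
    obtain q1 where q1: "q1 \<in> \<rat>" "p1 < q1" "q1 < q" using Rats_dense_in_real[OF p1(3)] by blast
    have "x \<in> steep u q1" using down[OF q(1)] q1 by (auto simp: U_def)
    then have "x \<notin> steep ?w (L - p1)" using x[OF p1(1) q1(1,2)] by blast
    from slope_le_of_not_steep[OF contw this] obtain d where
      d: "d > 0" "\<And>a b. a \<le> x \<Longrightarrow> x \<le> b \<Longrightarrow> b - a < d \<Longrightarrow> ?w b - ?w a \<le> (L - p1) * (b - a)"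
      by blast
    have "p * (b - a) \<le> u b - u a" if "a \<le> x" "x \<le> b" "b - a < d" for a b
    proof -
      have "p * (b - a) \<le> p1 * (b - a)" using p1 that by (intro mult_right_mono) auto
      with d(2)[OF that] show ?thesis by (simp add: algebra_simps)
    qed
    with d(1) show ?thesis by blast
  qed
  have "(u has_derivative (\<lambda>h. h * D)) (at x)"
    unfolding has_derivative_at_alt
  proof (intro conjI allI impI)
    show "bounded_linear (\<lambda>h. h * D)" by (simp add: bounded_linear_mult_left)
    fix e :: real assume "e > 0"
    then obtain d1 d2 where d: "d1 > 0" "d2 > 0"
      and d1: "\<And>a b. a \<le> x \<Longrightarrow> x \<le> b \<Longrightarrow> b - a < d1 \<Longrightarrow> u b - u a \<le> (D + e) * (b - a)"
      and d2: "\<And>a b. a \<le> x \<Longrightarrow> x \<le> b \<Longrightarrow> b - a < d2 \<Longrightarrow> (D - e) * (b - a) \<le> u b - u a"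
      using hi[of "D + e"] lo[of "D - e"] by auto
    have "norm (u y - u x - (y - x) * D) \<le> e * norm (y - x)" if "norm (y - x) < min d1 d2" for y
    proof (cases "x \<le> y")
      case True
      with that have "u y - u x \<le> (D + e) * (y - x)" "(D - e) * (y - x) \<le> u y - u x"
        by (auto intro!: d1 d2)
      with True show ?thesis by (simp add: algebra_simps abs_le_iff)
    next
      case False
      with that have "u x - u y \<le> (D + e) * (x - y)" "(D - e) * (x - y) \<le> u x - u y"
        by (auto intro!: d1 d2)
      with False show ?thesis by (simp add: algebra_simps abs_le_iff)
    qed
    with d show "\<exists>d>0. \<forall>y. norm (y - x) < d \<longrightarrow> norm (u y - u x - (y - x) * D) \<le> e * norm (y - x)"
      by (intro exI[of _ "min d1 d2"]) auto
  qed
  then show ?thesis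
    by (auto simp: has_vector_derivative_def)
qed

lemma lipschitz_real_ae_differentiable:
  fixes u :: "real \<Rightarrow> real"
  assumes "L-lipschitz_on UNIV u"
  shows "AE t in lborel. u differentiable at t"
proof -
  \<comment> \<open>Adding \<open>K * t\<close> makes \<open>u\<close> increasing with slopes at
    most \<open>2 * K\<close>; the summand 1 keeps \<open>K\<close> positive when
    \<open>L = 0\<close>.\<close>
  define K where "K = L + 1"
  have L0: "L \<ge> 0" using assms by (rule lipschitz_on_nonneg)
  have K: "K > 0" using L0 by (simp add: K_def)
  have lip: "\<bar>u t - u s\<bar> \<le> L * \<bar>t - s\<bar>" for s t
    using lipschitz_onD[OF assms, of t s] by (simp add: dist_real_def)
  define v where "v t = u t + K * t" for t
  have mono: "v s \<le> v t" if "s \<le> t" for s t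
    using lip[of t s] that by (simp add: v_def K_def algebra_simps abs_le_iff)
  have lipv: "v t - v s \<le> 2 * K * (t - s)" if "s \<le> t" for s t
    using lip[of t s] that by (simp add: v_def K_def algebra_simps abs_le_iff)
  have cont: "continuous_on UNIV v"
    unfolding v_def by (intro continuous_intros lipschitz_on_continuous_on[OF assms])
  have K2: "2 * K > 0" using K by simp
  \<comment> \<open>Rational pairs suffice for differentiability and keep the exceptional union
    countable.\<close>
  have "(\<Union>(p, q)\<in>{(p, q)\<in>\<rat> \<times> \<rat>. p < q}.
          steep v q \<inter> steep (\<lambda>t. 2 * K * t - v t) (2 * K - p)) \<in> null_sets lborel"
    (is "?N \<in> _")
  proof (rule null_sets_UN')
    have "countable (\<rat> \<times> \<rat> :: (real \<times> real) set)"
      by (intro countable_SIGMA countable_rat)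
    then show "countable {(p, q)\<in>\<rat> \<times> \<rat>. p < (q :: real)}"
      by (rule countable_subset[rotated]) auto
  qed (auto intro!: steep_oscillation_null[OF mono lipv cont K2])
  then show ?thesis
  proof (rule AE_I')
    show "{t \<in> space lborel. \<not> u differentiable at t} \<subseteq> ?N"
    proof (intro subsetI, rule ccontr)
      fix x assume x: "x \<in> {t \<in> space lborel. \<not> u differentiable at t}" "x \<notin> ?N"
      have "\<exists>D. (v has_vector_derivative D) (at x)"
        by (rule differentiable_outside_oscillation[OF mono lipv cont K2]) (use x(2) in auto)
      then obtain D where "(v has_vector_derivative D) (at x)" ..
      then have "((\<lambda>t. v t - K * t) has_vector_derivative (D - K)) (at x)"
        by (auto intro!: derivative_eq_intros)
      then have "u differentiable at x"
        by (auto simp: v_def dest: differentiableI_vector)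
      with x(1) show False by simp
    qed
  qed
qed

section \<open>Locally Lipschitz curves as integrals of their derivatives\<close>

lemma locally_lipschitz_ae_differentiable:
  fixes v :: "real \<Rightarrow> 'a::euclidean_space"
  assumes lip: "\<And>T. \<exists>L. L-lipschitz_on {t0..T} v"
  shows "AE t in lborel. t0 < t \<longrightarrow> v differentiable at t"
proof -
  \<comment> \<open>Clamping time to a compact interval makes each coordinate of \<open>v\<close>
    globally Lipschitz and changes nothing for \<open>t0 < t < t0 + n\<close>. Countably many
    \<open>n\<close> reach every such \<open>t\<close>.\<close>
  define c where "c n t = max t0 (min t (t0 + real n))" for n :: nat and t
  have "AE t in lborel. (\<lambda>t. v (c n t) \<bullet> b) differentiable at t" if "b \<in> Basis" for n b
  proof -
    obtain L where L: "L-lipschitz_on {t0..t0 + real n} v" using lip by blast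
    have "L-lipschitz_on UNIV (\<lambda>t. v (c n t) \<bullet> b)"
    proof (rule lipschitz_onI)
      fix s t :: real
      have "dist (v (c n s) \<bullet> b) (v (c n t) \<bullet> b) = \<bar>(v (c n s) - v (c n t)) \<bullet> b\<bar>"
        by (simp add: dist_real_def inner_diff_left)
      also have "\<dots> \<le> norm (v (c n s) - v (c n t))"
        using that by (rule Basis_le_norm)
      also have "\<dots> \<le> L * dist (c n s) (c n t)"
        unfolding dist_norm[symmetric] by (rule lipschitz_onD[OF L]) (auto simp: c_def)
      also have "\<dots> \<le> L * dist s t"
        using lipschitz_on_nonneg[OF L] by (intro mult_left_mono) (auto simp: c_def dist_real_def)
      finally show "dist (v (c n s) \<bullet> b) (v (c n t) \<bullet> b) \<le> L * dist s t" .
    qed (rule lipschitz_on_nonneg[OF L])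
    then show ?thesis by (rule lipschitz_real_ae_differentiable)
  qed
  then have "AE t in lborel. \<forall>n. \<forall>b\<in>Basis. (\<lambda>t. v (c n t) \<bullet> b) differentiable at t"
    by (simp add: AE_all_countable AE_finite_all)
  then show ?thesis
  proof eventually_elim
    case (elim t)
    show ?case
    proof
      assume t: "t0 < t"
      obtain n where n: "t - t0 < real n" using reals_Archimedean2 by blast
      have "(\<lambda>t. v (c n t)) differentiable at t"
        using elim by (subst differentiable_componentwise_within) auto
      then obtain D where D: "((\<lambda>t. v (c n t)) has_derivative D) (at t)"
        by (auto simp: differentiable_def)
      have "(v has_derivative D) (at t)"
      proof (rule has_derivative_transform_within_open[OF D])
        show "open {t0<..<t0 + real n}" "t \<in> {t0<..<t0 + real n}" using t n by auto
      qed (auto simp: c_def)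
      then show "v differentiable at t" by (auto simp: differentiable_def)
    qed
  qed
qed

text \<open>Along a fixed sequence of forward steps the derivative is a pointwise limit. This yields
  its measurability and its membership in closed sets that contain the quotients.\<close>

lemma has_vector_derivative_sequential_quotient:
  assumes "(f has_vector_derivative D) (at t)"
  shows "(\<lambda>n. real (Suc n) *\<^sub>R (f (t + 1 / real (Suc n)) - f t)) \<longlonglongrightarrow> D"
proof -
  have "(\<lambda>h. norm (f (t + h) - f t - h *\<^sub>R D) / norm h) \<midarrow>0\<rightarrow> 0"
    using assms by (simp add: has_vector_derivative_def has_derivative_at)
  moreover have "filterlim (\<lambda>n. 1 / real (Suc n)) (at 0) sequentially"
    unfolding filterlim_at using LIMSEQ_inverse_real_of_nat by (simp add: inverse_eq_divide)
  ultimately have "(\<lambda>n. norm (f (t + 1 / real (Suc n)) - f t - (1 / real (Suc n)) *\<^sub>R D) / norm (1 / real (Suc n)))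
      \<longlonglongrightarrow> 0"
    by (rule filterlim_compose)
  moreover have "norm (f (t + 1 / real (Suc n)) - f t - (1 / real (Suc n)) *\<^sub>R D) / norm (1 / real (Suc n))
     = norm (real (Suc n) *\<^sub>R (f (t + 1 / real (Suc n)) - f t) - D)" for n
  proof -
    have "real (Suc n) *\<^sub>R (f (t + 1 / real (Suc n)) - f t) - D
        = real (Suc n) *\<^sub>R (f (t + 1 / real (Suc n)) - f t - (1 / real (Suc n)) *\<^sub>R D)"
      by (simp add: scaleR_diff_right del: of_nat_Suc)
    then show ?thesis unfolding norm_scaleR by (simp del: of_nat_Suc)
  qed
  ultimately have "(\<lambda>n. norm (real (Suc n) *\<^sub>R (f (t + 1 / real (Suc n)) - f t) - D)) \<longlonglongrightarrow> 0"
    by simp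
  then show ?thesis
    by (rule Lim_null[THEN iffD2, OF tendsto_norm_zero_cancel])
qed

text \<open>The difference quotients are bounded by the Lipschitz constant and converge almost
  everywhere, so dominated convergence applies. Their integrals are differences of two short
  averages of \<open>v\<close>, near \<open>T\<close> and near \<open>t0\<close>, and converge by
  continuity.\<close>

lemma locally_lipschitz_integral_derivative:
  fixes v :: "real \<Rightarrow> 'a::euclidean_space"
  assumes lip: "\<And>T. \<exists>L. L-lipschitz_on {t0..T} v"
  shows "\<exists>a\<in>borel_measurable borel.
    (\<forall>t\<ge>t0. set_integrable lborel {t0..t} a \<and> v t = v t0 + (LINT s:{t0..t}|lborel. a s)) \<and>
    (AE t in lborel. t0 < t \<longrightarrow> (v has_vector_derivative a t) (at t))"
proof -
  \<comment> \<open>The values of \<open>v\<close> before \<open>t0\<close> are unknown; the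
    constant extension is continuous on the whole line.\<close>
  define w where "w t = v (max t t0)" for t
  define h where "h n = 1 / real (Suc n)" for n
  have h: "h n > 0" "h n \<le> 1" for n by (auto simp: h_def)
  define D where "D n t = real (Suc n) *\<^sub>R (w (t + h n) - w t)" for n t
  \<comment> \<open>A limit of the continuous \<open>D n\<close> is Borel on the whole line,
    whatever value \<open>lim\<close> takes where the sequence diverges.\<close>
  define a where "a t = lim (\<lambda>n. D n t)" for t
  have contv: "continuous_on {t0..T} v" for T
    using lip lipschitz_on_continuous_on by blast
  have cont: "continuous_on UNIV w"
  proof -
    have "isCont w t" for t
    proof -
      have "continuous_on {..<t + 1} w"
        unfolding w_def
        by (rule continuous_on_compose2[OF contv[of "max (t + 1) t0"]]) (auto intro!: continuous_intros)
      then show ?thesis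
        by (simp add: continuous_on_eq_continuous_at)
    qed
    then show ?thesis by (simp add: continuous_on_eq_continuous_at)
  qed
  have contD: "continuous_on UNIV (D n)" for n
    unfolding D_def by (intro continuous_intros continuous_on_compose2[OF cont]) auto
  have measD[measurable]: "D n \<in> borel_measurable borel" for n
    by (rule borel_measurable_continuous_onI[OF contD])
  have meas[measurable]: "a \<in> borel_measurable borel"
    unfolding a_def by measurable
  have "AE t in lborel. t0 < t \<longrightarrow> v differentiable at t"
    by (rule locally_lipschitz_ae_differentiable[OF lip])
  then have lim: "AE t in lborel. t0 < t \<longrightarrow> (v has_vector_derivative a t) (at t) \<and> (\<lambda>n. D n t) \<longlonglongrightarrow> a t"
  proof eventually_elim
    case (elim t)
    show ?case
    proof
      assume t: "t0 < t"
      with elim have v': "(v has_vector_derivative vector_derivative v (at t)) (at t)"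
        using vector_derivative_works by blast
      have "(\<lambda>n. D n t) \<longlonglongrightarrow> vector_derivative v (at t)"
      proof -
        have "D n t = real (Suc n) *\<^sub>R (v (t + h n) - v t)" for n
          using t h(1)[of n] by (simp add: D_def w_def max_absorb1 del: of_nat_Suc)
        then have "D n t = real (Suc n) *\<^sub>R (v (t + 1 / real (Suc n)) - v t)" for n
          unfolding h_def .
        then show ?thesis using has_vector_derivative_sequential_quotient[OF v'] by simp
      qed
      moreover from this have "a t = vector_derivative v (at t)"
        unfolding a_def by (rule limI)
      ultimately show "(v has_vector_derivative a t) (at t) \<and> (\<lambda>n. D n t) \<longlonglongrightarrow> a t"
        using v' by simp
    qed
  qed
  have "set_integrable lborel {t0..T} a \<and> v T = v t0 + (LINT s:{t0..T}|lborel. a s)" if T: "t0 \<le> T" for T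
  proof -
    \<comment> \<open>The quotients look ahead by \<open>h n \<le> 1\<close>, hence the interval up
      to \<open>T + 1\<close>.\<close>
    obtain L where L: "L-lipschitz_on {t0..T + 1} v" using lip by blast
    have ae: "AE t in lborel. (\<lambda>n. indicator {t0..T} t *\<^sub>R D n t) \<longlonglongrightarrow> indicator {t0..T} t *\<^sub>R a t"
      using lim AE_lborel_singleton[of t0]
      by eventually_elim (auto intro!: tendsto_intros split: split_indicator)
    have bound: "norm (indicator {t0..T} t *\<^sub>R D n t) \<le> L * indicator {t0..T} t" for n t
    proof (cases "t \<in> {t0..T}")
      case True
      have "norm (w (t + h n) - w t) \<le> L * dist (t + h n) t"
        unfolding dist_norm[symmetric] w_def using True h[of n]
        by (simp add: max_absorb1 order_trans[of t0 t]) (rule lipschitz_onD[OF L], auto)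
      then have "real (Suc n) * norm (w (t + h n) - w t) \<le> real (Suc n) * (L * h n)"
        using h[of n] by (intro mult_left_mono) (auto simp: dist_real_def)
      also have "\<dots> = L" by (simp add: h_def del: of_nat_Suc)
      finally show ?thesis using True by (simp add: D_def del: of_nat_Suc)
    qed simp
    have int: "integrable lborel (\<lambda>t. L * indicator {t0..T} t)"
      by (intro integrable_mult_right) (simp add: T)
    have "integrable lborel (\<lambda>t. indicator {t0..T} t *\<^sub>R a t)"
      by (rule integrable_dominated_convergence[OF _ _ int ae AE_I2[OF bound]]) measurable
    moreover have "(LINT t|lborel. indicator {t0..T} t *\<^sub>R a t) = v T - v t0"
    proof (rule LIMSEQ_unique)
      show "(\<lambda>n. LINT t|lborel. indicator {t0..T} t *\<^sub>R D n t)
          \<longlonglongrightarrow> (LINT t|lborel. indicator {t0..T} t *\<^sub>R a t)"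
        by (rule integral_dominated_convergence[OF _ _ int ae AE_I2[OF bound]]) measurable
      \<comment> \<open>Starting at \<open>t0 - 1\<close> makes this antiderivative of
        \<open>w\<close> differentiable from both sides at \<open>t0\<close>.\<close>
      define W where "W t = integral {t0 - 1..t} w" for t
      have W: "(W has_vector_derivative w t) (at t)" if "t0 - 1 < t" for t
      proof -
        have "(W has_vector_derivative w t) (at t within {t0 - 1..t + 1})"
          unfolding W_def using that
          by (intro integral_has_vector_derivative continuous_on_subset[OF cont]) auto
        then show ?thesis
          using that by (subst (asm) at_within_interior) auto
      qed
      have "(LINT t|lborel. indicator {t0..T} t *\<^sub>R D n t)
          = real (Suc n) *\<^sub>R (W (T + h n) - W T) - real (Suc n) *\<^sub>R (W (t0 + h n) - W t0)" for n
      proof -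
        have "((\<lambda>t. real (Suc n) *\<^sub>R (W (t + h n) - W t)) has_vector_derivative D n t)
            (at t within {t0..T})" if "t0 \<le> t" for t
        proof -
          have "((\<lambda>t. W (t + h n)) has_vector_derivative w (t + h n)) (at t)"
          proof -
            have "((W \<circ> (\<lambda>t. t + h n)) has_vector_derivative 1 *\<^sub>R w (t + h n)) (at t)"
              using that h[of n]
              by (intro vector_diff_chain_at W) (auto intro!: derivative_eq_intros)
            then show ?thesis by (simp add: o_def)
          qed
          then have "((\<lambda>t. W (t + h n)) has_vector_derivative w (t + h n)) (at t within {t0..T})"
            "(W has_vector_derivative w t) (at t within {t0..T})"
            using W[of t] that by (auto intro: has_vector_derivative_at_within)
          then show ?thesis
            unfolding D_def
            by (intro bounded_linear.has_vector_derivative[OF bounded_linear_scaleR_right]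
                has_vector_derivative_diff)
        qed
        from integral_FTC_Icc[OF T this continuous_on_subset[OF contD]]
        show ?thesis by (simp add: scaleR_diff_right)
      qed
      moreover have "(\<lambda>n. real (Suc n) *\<^sub>R (W (T + h n) - W T) - real (Suc n) *\<^sub>R (W (t0 + h n) - W t0))
          \<longlonglongrightarrow> w T - w t0"
        unfolding h_def using T
        by (intro tendsto_diff has_vector_derivative_sequential_quotient W) auto
      moreover have "w T - w t0 = v T - v t0" using T by (simp add: w_def max_absorb1)
      ultimately show "(\<lambda>n. LINT t|lborel. indicator {t0..T} t *\<^sub>R D n t) \<longlonglongrightarrow> v T - v t0"
        by simp
    qed
    ultimately show ?thesis
      by (simp add: set_integrable_def set_lebesgue_integral_def)
  qed
  moreover have "AE t in lborel. t0 < t \<longrightarrow> (v has_vector_derivative a t) (at t)"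
    using lim by eventually_elim simp
  ultimately show ?thesis using meas by blast
qed

section \<open>Krasovskii solutions without derivatives\<close>

text \<open>A convex closed set absorbing the values of \<open>F\<close> near \<open>(t, y t)\<close> absorbs the difference quotients of
  \<open>y\<close> at \<open>t\<close>: \<open>y\<close> solves the inclusion given by the Krasovskii regularisation of \<open>F\<close>, but without
  mentioning a derivative.\<close>
definition krasovskii_at :: "(real \<Rightarrow> 'a \<Rightarrow> 'a) \<Rightarrow> real \<Rightarrow> (real \<Rightarrow> 'a::real_normed_vector) \<Rightarrow> real \<Rightarrow> bool" where
  "krasovskii_at F t0 y t \<longleftrightarrow> (\<forall>S \<delta>. convex S \<and> closed S \<and> \<delta> > 0 \<and>
      (\<forall>s z. s \<ge> t0 \<longrightarrow> \<bar>s - t\<bar> < \<delta> \<longrightarrow> dist z (y t) < \<delta> \<longrightarrow> F s z \<in> S) \<longrightarrow>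
      (\<exists>\<eta>>0. \<forall>s\<ge>t0. s \<noteq> t \<and> \<bar>s - t\<bar> < \<eta> \<longrightarrow> (y s - y t) /\<^sub>R (s - t) \<in> S))"

lemma krasovskii_atD:
  assumes "krasovskii_at F t0 y t" "convex S" "closed S" "\<delta> > 0"
    "\<And>s z. s \<ge> t0 \<Longrightarrow> \<bar>s - t\<bar> < \<delta> \<Longrightarrow> dist z (y t) < \<delta> \<Longrightarrow> F s z \<in> S"
  shows "\<exists>\<eta>>0. \<forall>s\<ge>t0. s \<noteq> t \<and> \<bar>s - t\<bar> < \<eta> \<longrightarrow> (y s - y t) /\<^sub>R (s - t) \<in> S"
  using assms unfolding krasovskii_at_def by blast

section \<open>Limits of the Euler scheme\<close>

primrec euler :: "(real \<Rightarrow> 'a \<Rightarrow> 'a) \<Rightarrow> real \<Rightarrow> real \<Rightarrow> 'a \<Rightarrow> nat \<Rightarrow> 'a::real_vector" where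
  "euler F t0 h y0 0 = y0"
| "euler F t0 h y0 (Suc k) = euler F t0 h y0 k + h *\<^sub>R F (t0 + real k * h) (euler F t0 h y0 k)"

text \<open>Discrete Gronwall: one step multiplies \<open>1 + norm\<close> by at most
  \<open>1 + K * h \<le> exp (K * h)\<close>.\<close>

lemma euler_norm_bound:
  fixes F :: "real \<Rightarrow> 'a \<Rightarrow> 'a::real_normed_vector"
  assumes growth: "\<And>t y. t \<ge> t0 \<Longrightarrow> norm (F t y) \<le> K * (1 + norm y)" and "h \<ge> 0" "K \<ge> 0"
  shows "1 + norm (euler F t0 h y0 k) \<le> (1 + norm y0) * exp (K * (real k * h))"
proof (induction k)
  case (Suc k)
  let ?Y = "euler F t0 h y0 k"
  have "1 + norm (euler F t0 h y0 (Suc k)) \<le> 1 + norm ?Y + h * norm (F (t0 + real k * h) ?Y)"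
    using norm_triangle_ineq[of ?Y "h *\<^sub>R F (t0 + real k * h) ?Y"] \<open>h \<ge> 0\<close> by simp
  also have "\<dots> \<le> 1 + norm ?Y + h * (K * (1 + norm ?Y))"
    using assms by (intro add_left_mono mult_left_mono growth) auto
  also have "\<dots> = (1 + norm ?Y) * (1 + K * h)" by (simp add: algebra_simps)
  also have "\<dots> \<le> (1 + norm ?Y) * exp (K * h)"
    by (intro mult_left_mono exp_ge_add_one_self) auto
  also have "\<dots> \<le> ((1 + norm y0) * exp (K * (real k * h))) * exp (K * h)"
    using Suc by (intro mult_right_mono) auto
  also have "\<dots> = (1 + norm y0) * exp (K * (real (Suc k) * h))"
    by (simp add: algebra_simps exp_add)
  finally show ?case .
qed simp

lemma euler_diff:
  assumes "k \<le> l"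
  shows "euler F t0 h y0 l - euler F t0 h y0 k
      = h *\<^sub>R (\<Sum>j = k..<l. F (t0 + real j * h) (euler F t0 h y0 j))"
  using assms
proof (induction l rule: dec_induct)
  case (step l)
  then show ?case
    by (simp add: scaleR_add_right algebra_simps)
qed simp

text \<open>Up to time \<open>T\<close> the Gronwall bound controls every field value that is
  summed. The resulting constant does not depend on \<open>h\<close>, which gives equicontinuity of
  the scheme.\<close>

lemma euler_diff_bound:
  fixes F :: "real \<Rightarrow> 'a \<Rightarrow> 'a::real_normed_vector"
  assumes growth: "\<And>t y. t \<ge> t0 \<Longrightarrow> norm (F t y) \<le> K * (1 + norm y)" and "h \<ge> 0" "K \<ge> 0"
    and l: "t0 + real l * h \<le> T" and "k \<le> l"
  shows "norm (euler F t0 h y0 l - euler F t0 h y0 k)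
      \<le> K * ((1 + norm y0) * exp (K * (T - t0))) * (real l * h - real k * h)"
proof -
  let ?B = "K * ((1 + norm y0) * exp (K * (T - t0)))"
  have "norm (F (t0 + real j * h) (euler F t0 h y0 j)) \<le> ?B" if "j \<in> {k..<l}" for j
  proof -
    have "real j * h \<le> real l * h" using that \<open>h \<ge> 0\<close> by (intro mult_right_mono) auto
    then have "real j * h \<le> T - t0" using l by simp
    then have "exp (K * (real j * h)) \<le> exp (K * (T - t0))"
      using \<open>K \<ge> 0\<close> by (simp add: mult_left_mono)
    have "norm (F (t0 + real j * h) (euler F t0 h y0 j)) \<le> K * (1 + norm (euler F t0 h y0 j))"
      using \<open>h \<ge> 0\<close> by (intro growth) auto
    also have "\<dots> \<le> K * ((1 + norm y0) * exp (K * (real j * h)))"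
      using \<open>K \<ge> 0\<close> \<open>h \<ge> 0\<close> by (intro mult_left_mono euler_norm_bound growth) auto
    also have "\<dots> \<le> ?B"
      using \<open>K \<ge> 0\<close> \<open>exp (K * (real j * h)) \<le> exp (K * (T - t0))\<close>
      by (intro mult_left_mono) auto
    finally show ?thesis .
  qed
  then have "norm (\<Sum>j = k..<l. F (t0 + real j * h) (euler F t0 h y0 j)) \<le> real (card {k..<l}) * ?B"
    by (rule sum_norm_bound)
  then have "h * norm (\<Sum>j = k..<l. F (t0 + real j * h) (euler F t0 h y0 j)) \<le> h * (real (l - k) * ?B)"
    using \<open>h \<ge> 0\<close> by (intro mult_left_mono) auto
  also have "\<dots> = ?B * (real l * h - real k * h)"
    using \<open>k \<le> l\<close> by (simp add: of_nat_diff algebra_simps)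
  finally show ?thesis
    using \<open>h \<ge> 0\<close> by (simp add: euler_diff[OF \<open>k \<le> l\<close>])
qed

text \<open>Between two mesh points the difference quotient is the average of the field values used,
  with equal weights \<open>1 / (l - k)\<close>.\<close>

lemma euler_quotient_in_convex:
  assumes S: "convex S" and "k < l"
    and F: "\<And>j. k \<le> j \<Longrightarrow> j < l \<Longrightarrow> F (t0 + real j * h) (euler F t0 h y0 j) \<in> S" and "h > 0"
  shows "(euler F t0 h y0 l - euler F t0 h y0 k) /\<^sub>R (real l * h - real k * h) \<in> S"
proof -
  let ?G = "\<lambda>j. F (t0 + real j * h) (euler F t0 h y0 j)"
  have "(\<Sum>j = k..<l. (1 / real (l - k)) *\<^sub>R ?G j) \<in> S"
    using \<open>k < l\<close> by (intro convex_sum S F) auto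
  also have "(\<Sum>j = k..<l. (1 / real (l - k)) *\<^sub>R ?G j) = (h *\<^sub>R (\<Sum>j = k..<l. ?G j)) /\<^sub>R (real l * h - real k * h)"
  proof -
    have *: "real l * h - real k * h = h * real (l - k)"
      using \<open>k < l\<close> by (simp add: of_nat_diff algebra_simps)
    show ?thesis unfolding * using \<open>h > 0\<close>
      by (simp add: scaleR_sum_right[symmetric] inverse_eq_divide del: of_nat_diff)
  qed
  finally show ?thesis
    using \<open>k < l\<close> by (simp add: euler_diff)
qed

text \<open>A diagonal subsequence converges at all rational times, and the Lipschitz estimate with
  error \<open>h n\<close> extends convergence to all times. Quotients of the iterates lie in
  \<open>S\<close> by averaging, and closedness of \<open>S\<close> passes this to the
  limit.\<close>

lemma euler_polygons_limit:
  fixes F :: "real \<Rightarrow> 'a \<Rightarrow> 'a::euclidean_space"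
  assumes growth: "\<And>t y. t \<ge> t0 \<Longrightarrow> norm (F t y) \<le> K * (1 + norm y)"
  shows "\<exists>y. y t0 = y0 \<and> (\<forall>T. \<exists>L. L-lipschitz_on {t0..T} y) \<and> (\<forall>t\<ge>t0. krasovskii_at F t0 y t)"
proof -
  have K: "K \<ge> 0" using growth[of t0 0] by (simp add: order_trans[OF norm_ge_zero])
  define h where "h n = 1 / real (Suc n)" for n
  have h: "h n > 0" for n by (simp add: h_def)
  have h0: "h \<longlonglongrightarrow> 0"
    unfolding h_def using LIMSEQ_inverse_real_of_nat by (simp add: inverse_eq_divide)
  define Y where "Y n = euler F t0 (h n) y0" for n
  \<comment> \<open>Index of the last mesh point not after \<open>t\<close>. The interpolation
    \<open>z\<close> is a step function, hence Lipschitz only up to the mesh width.\<close>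
  define N where "N n t = nat \<lfloor>(t - t0) / h n\<rfloor>" for n t
  define z where "z n t = Y n (N n t)" for n t
  define B where "B T = (1 + norm y0) * exp (K * (T - t0))" for T
  have B: "B T > 0" for T by (simp add: B_def add_pos_nonneg)
  have N: "real (N n t) * h n \<le> t - t0" "t - t0 < real (N n t) * h n + h n" if "t \<ge> t0" for n t
  proof -
    have "real (N n t) = of_int \<lfloor>(t - t0) / h n\<rfloor>"
      using that h[of n] by (simp add: N_def)
    then have "real (N n t) \<le> (t - t0) / h n" "(t - t0) / h n < real (N n t) + 1"
      by linarith+
    then show "real (N n t) * h n \<le> t - t0" "t - t0 < real (N n t) * h n + h n"
      using h[of n] by (simp_all add: field_simps)
  qed
  have Nmono: "N n s \<le> N n t" if "s \<le> t" for n s t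
    unfolding N_def using that h[of n] by (intro nat_mono floor_mono divide_right_mono) auto
  have Ybound: "norm (Y n l - Y n k) \<le> K * B T * (real l * h n - real k * h n)"
    if "k \<le> l" "t0 + real l * h n \<le> T" for n k l T
    unfolding Y_def B_def using that h[of n] K by (intro euler_diff_bound growth) auto
  have zbound: "norm (z n t) \<le> B t" if "t \<ge> t0" for n t
  proof -
    have "1 + norm (z n t) \<le> (1 + norm y0) * exp (K * (real (N n t) * h n))"
      unfolding z_def Y_def using h[of n] K by (intro euler_norm_bound growth) auto
    also have "\<dots> \<le> B t"
      unfolding B_def using N(1)[OF that] K by (intro mult_left_mono) (auto intro: mult_left_mono)
    finally show ?thesis by simp
  qed
  have zlip: "dist (z n t) (z n s) \<le> K * B T * (\<bar>t - s\<bar> + h n)"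
    if "s \<in> {t0..T}" "t \<in> {t0..T}" for n s t T
    using that
  proof (induction s t rule: linorder_wlog)
    case (le s t)
    have "dist (z n t) (z n s) \<le> K * B T * (real (N n t) * h n - real (N n s) * h n)"
      unfolding dist_norm z_def using Nmono[OF le(1)] N(1)[of t n] le by (intro Ybound) auto
    also have "\<dots> \<le> K * B T * (\<bar>t - s\<bar> + h n)"
      using N[of t n] N[of s n] le K B[of T] by (intro mult_left_mono) auto
    finally show ?case .
  next
    case (sym s t)
    then show ?case by (simp add: dist_commute abs_minus_commute)
  qed
  \<comment> \<open>The subsequence theorem asks for one bound at all points, so the values are
    divided by \<open>B r\<close> and rescaled afterwards.\<close>
  obtain \<kappa> where \<kappa>: "strict_mono (\<kappa> :: nat \<Rightarrow> nat)"
    "\<And>r. r \<in> \<rat> \<inter> {t0..} \<Longrightarrow> \<exists>l. (\<lambda>n. (1 / B r) *\<^sub>R z (\<kappa> n) r) \<longlonglongrightarrow> l"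
  proof (rule function_convergent_subsequence[of "\<rat> \<inter> {t0..}" "\<lambda>n r. (1 / B r) *\<^sub>R z n r" 1])
    show "countable (\<rat> \<inter> {t0..})" by (simp add: countable_rat)
    show "norm ((1 / B r) *\<^sub>R z n r) \<le> 1" if "r \<in> \<rat> \<inter> {t0..}" for n r
      using zbound[of r n] that B[of r] by simp
  qed blast
  have h\<kappa>: "(\<lambda>n. h (\<kappa> n)) \<longlonglongrightarrow> 0"
    using LIMSEQ_subseq_LIMSEQ[OF h0 \<kappa>(1)] by (simp add: o_def)
  have conv_rat: "convergent (\<lambda>n. z (\<kappa> n) r)" if r: "r \<in> \<rat>" "r \<ge> t0" for r
  proof -
    obtain l where "(\<lambda>n. (1 / B r) *\<^sub>R z (\<kappa> n) r) \<longlonglongrightarrow> l" using \<kappa>(2)[of r] r by auto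
    then have "(\<lambda>n. B r *\<^sub>R ((1 / B r) *\<^sub>R z (\<kappa> n) r)) \<longlonglongrightarrow> B r *\<^sub>R l"
      by (intro tendsto_intros)
    then show ?thesis using B[of r] by (auto simp: convergent_def)
  qed
  have "convergent (\<lambda>n. z (\<kappa> n) t)" if t: "t \<ge> t0" for t
  proof -
    have "Cauchy (\<lambda>n. z (\<kappa> n) t)"
    proof (rule metric_CauchyI)
      fix e :: real assume e: "e > 0"
      define C where "C = K * B (t + 1) + 1"
      have C: "C > 0" "K * B (t + 1) \<le> C"
        using K B[of "t + 1"] by (simp_all add: C_def add_nonneg_pos)
      \<comment> \<open>The distance to \<open>r\<close> and the mesh width are each below
        \<open>d\<close>, and \<open>C * (2 * d) \<le> e / 3\<close>; the bound 1 keeps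
        \<open>r\<close> below \<open>t + 1\<close>.\<close>
      define d where "d = min 1 (e / (6 * C))"
      have d: "d > 0" using e C by (simp add: d_def)
      obtain r where r: "r \<in> \<rat>" "t < r" "r < t + d"
        using Rats_dense_in_real[of t "t + d"] d by auto
      have close: "\<forall>\<^sub>F n in sequentially. dist (z (\<kappa> n) t) (z (\<kappa> n) r) < e / 3"
        using order_tendstoD(2)[OF h\<kappa> d]
      proof eventually_elim
        case (elim n)
        have "dist (z (\<kappa> n) t) (z (\<kappa> n) r) \<le> K * B (t + 1) * (\<bar>t - r\<bar> + h (\<kappa> n))"
          using r t by (intro zlip) (auto simp: d_def)
        also have "\<dots> \<le> C * (\<bar>t - r\<bar> + h (\<kappa> n))"
          using C h[of "\<kappa> n"] by (intro mult_right_mono) auto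
        also have "\<dots> < C * (2 * d)"
          using C elim r by (intro mult_strict_left_mono) auto
        also have "\<dots> \<le> e / 3"
          using C by (simp add: d_def min_def field_simps)
        finally show ?case .
      qed
      have "Cauchy (\<lambda>n. z (\<kappa> n) r)"
        using conv_rat[of r] r t by (simp add: convergent_Cauchy)
      then obtain M1 where M1: "\<And>m n. m \<ge> M1 \<Longrightarrow> n \<ge> M1 \<Longrightarrow> dist (z (\<kappa> m) r) (z (\<kappa> n) r) < e / 3"
        using metric_CauchyD[of _ "e / 3"] e by fastforce
      obtain M2 where M2: "\<And>n. n \<ge> M2 \<Longrightarrow> dist (z (\<kappa> n) t) (z (\<kappa> n) r) < e / 3"
        using close unfolding eventually_sequentially by blast
      have "dist (z (\<kappa> m) t) (z (\<kappa> n) t) < e" if "m \<ge> max M1 M2" "n \<ge> max M1 M2" for m n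
        using M1[of m n] M2[of m] M2[of n] that
          dist_triangle[of "z (\<kappa> m) t" "z (\<kappa> n) t" "z (\<kappa> m) r"]
          dist_triangle[of "z (\<kappa> m) r" "z (\<kappa> n) t" "z (\<kappa> n) r"]
          dist_commute[of "z (\<kappa> n) t" "z (\<kappa> n) r"]
        by simp
      then show "\<exists>M. \<forall>m\<ge>M. \<forall>n\<ge>M. dist (z (\<kappa> m) t) (z (\<kappa> n) t) < e"
        by blast
    qed
    then show ?thesis by (rule Cauchy_convergent)
  qed
  then obtain y where y: "\<And>t. t \<ge> t0 \<Longrightarrow> (\<lambda>n. z (\<kappa> n) t) \<longlonglongrightarrow> y t"
    unfolding convergent_def by metis
  show ?thesis
  proof (intro exI[of _ y] conjI allI impI)
    have "z n t0 = y0" for n by (simp add: z_def N_def Y_def)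
    with y[of t0] show "y t0 = y0" by (simp add: LIMSEQ_const_iff)
    show "\<exists>L. L-lipschitz_on {t0..T} y" for T
    proof (intro exI lipschitz_onI)
      fix s t assume st: "s \<in> {t0..T}" "t \<in> {t0..T}"
      have "dist (y s) (y t) \<le> K * B T * (\<bar>s - t\<bar> + 0)"
      proof (rule tendsto_le[OF sequentially_bot])
        show "(\<lambda>n. K * B T * (\<bar>s - t\<bar> + h (\<kappa> n))) \<longlonglongrightarrow> K * B T * (\<bar>s - t\<bar> + 0)"
          by (intro tendsto_intros h\<kappa>)
        show "(\<lambda>n. dist (z (\<kappa> n) s) (z (\<kappa> n) t)) \<longlonglongrightarrow> dist (y s) (y t)"
          using st by (intro tendsto_dist y) auto
        show "\<forall>\<^sub>F n in sequentially. dist (z (\<kappa> n) s) (z (\<kappa> n) t) \<le> K * B T * (\<bar>s - t\<bar> + h (\<kappa> n))"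
          using zlip[OF st(2,1)] by (intro always_eventually) auto
      qed
      then show "dist (y s) (y t) \<le> K * B T * dist s t" by (simp add: dist_real_def)
    qed (use K B[of T] in auto)
  next
    fix t assume t: "t \<ge> t0"
    show "krasovskii_at F t0 y t"
      unfolding krasovskii_at_def
    proof (intro allI impI, elim conjE)
      fix S and \<delta> :: real
      assume S: "convex S" "closed S" and \<delta>: "\<delta> > 0"
        and FS': "\<forall>s z. s \<ge> t0 \<longrightarrow> \<bar>s - t\<bar> < \<delta> \<longrightarrow> dist z (y t) < \<delta> \<longrightarrow> F s z \<in> S"
      have FS: "F s z \<in> S" if "s \<ge> t0" "\<bar>s - t\<bar> < \<delta>" "dist z (y t) < \<delta>" for s z
        using FS' that by blast
      define C where "C = K * B (t + 1) + 1"
      have C: "C \<ge> 1" "K * B (t + 1) \<le> C"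
        using K B[of "t + 1"] by (simp_all add: C_def)
      \<comment> \<open>An iterate between \<open>a\<close> and \<open>b\<close> differs from
        \<open>z\<close> at \<open>t\<close> by at most
        \<open>2 * C * \<eta> \<le> 2 * \<delta> / 3\<close>; the last third is for the convergence
        of \<open>z\<close> to \<open>y\<close>.\<close>
      define \<eta> where "\<eta> = min 1 (\<delta> / (3 * C))"
      have \<eta>: "\<eta> > 0" "\<eta> \<le> 1" "C * \<eta> \<le> \<delta> / 3"
        using \<delta> C by (auto simp: \<eta>_def min_def field_simps)
      have "1 * \<eta> \<le> C * \<eta>" using C \<eta> by (intro mult_right_mono) auto
      then have \<eta>': "\<eta> \<le> \<delta> / 3" using \<eta>(3) by simp
      have in_S: "(y b - y a) /\<^sub>R (b - a) \<in> S"
        if ab: "t0 \<le> a" "a < b" "a = t \<or> b = t" "b - a < \<eta>" for a b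
      proof -
        have lims: "(\<lambda>n. real (N (\<kappa> n) c) * h (\<kappa> n)) \<longlonglongrightarrow> c - t0" if "c \<ge> t0" for c
        proof (rule tendsto_sandwich)
          show "(\<lambda>n. c - t0 - h (\<kappa> n)) \<longlonglongrightarrow> c - t0"
            using tendsto_diff[OF tendsto_const h\<kappa>, of "c - t0"] by simp
          show "\<forall>\<^sub>F n in sequentially. c - t0 - h (\<kappa> n) \<le> real (N (\<kappa> n) c) * h (\<kappa> n)"
            using N(2)[OF that] by (intro always_eventually allI) (simp add: algebra_simps less_imp_le)
          show "\<forall>\<^sub>F n in sequentially. real (N (\<kappa> n) c) * h (\<kappa> n) \<le> c - t0"
            using N(1)[OF that] by (intro always_eventually allI)
        qed simp
        \<comment> \<open>The denominator uses mesh points instead of \<open>a\<close> and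
          \<open>b\<close>, which makes the quotient an exact average; it still tends to
          \<open>b - a\<close>.\<close>
        let ?Q = "\<lambda>n. (z (\<kappa> n) b - z (\<kappa> n) a) /\<^sub>R (real (N (\<kappa> n) b) * h (\<kappa> n) - real (N (\<kappa> n) a) * h (\<kappa> n))"
        have limQ: "?Q \<longlonglongrightarrow> (y b - y a) /\<^sub>R ((b - t0) - (a - t0))"
          using ab by (intro tendsto_intros y lims) auto
        have "\<forall>\<^sub>F n in sequentially. h (\<kappa> n) < \<eta>"
          using order_tendstoD(2)[OF h\<kappa> \<eta>(1)] .
        moreover have "\<forall>\<^sub>F n in sequentially. h (\<kappa> n) < b - a"
          using order_tendstoD(2)[OF h\<kappa>, of "b - a"] ab by simp
        moreover have "\<forall>\<^sub>F n in sequentially. dist (z (\<kappa> n) t) (y t) < \<delta> / 3"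
          using tendstoD[OF y[OF t], of "\<delta> / 3"] \<delta> by simp
        ultimately have "\<forall>\<^sub>F n in sequentially. ?Q n \<in> S"
        proof eventually_elim
          case (elim n)
          let ?m = "\<kappa> n"
          \<comment> \<open>A mesh width below \<open>b - a\<close> guarantees at least one Euler
            step, so the average is not empty.\<close>
          have less: "N ?m a < N ?m b"
          proof -
            have "real (N ?m a) * h ?m < real (N ?m b) * h ?m"
              using N(1)[of a ?m] N(2)[of b ?m] ab elim by linarith
            then show ?thesis using h[of ?m] by simp
          qed
          show ?case
            unfolding z_def Y_def
          proof (rule euler_quotient_in_convex[OF S(1) less _ h])
            fix j assume j: "N ?m a \<le> j" "j < N ?m b"
            have lo: "real (N ?m a) * h ?m \<le> real j * h ?m" and hi: "real j * h ?m \<le> real (N ?m b) * h ?m"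
              using j h[of ?m] by (auto intro!: mult_right_mono)
            have tj: "a - h ?m < t0 + real j * h ?m" "t0 + real j * h ?m \<le> b"
              using lo hi N(2)[of a ?m] N(1)[of b ?m] ab by auto
            have "norm (Y ?m j - Y ?m (N ?m t)) \<le> K * B (t + 1) * (b - a + h ?m)"
            proof (cases "a = t")
              case True
              have "norm (Y ?m j - Y ?m (N ?m t)) \<le> K * B (t + 1) * (real j * h ?m - real (N ?m t) * h ?m)"
                using j True tj ab \<eta> by (intro Ybound) auto
              also have "\<dots> \<le> K * B (t + 1) * (b - a + h ?m)"
                using tj N(2)[of a ?m] True ab K B[of "t + 1"] by (intro mult_left_mono) auto
              finally show ?thesis .
            next
              case False
              with ab have bt: "b = t" by simp
              have "norm (Y ?m (N ?m t) - Y ?m j) \<le> K * B (t + 1) * (real (N ?m t) * h ?m - real j * h ?m)"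
                using j bt N(1)[of t ?m] t by (intro Ybound) auto
              also have "\<dots> \<le> K * B (t + 1) * (b - a + h ?m)"
                using tj N(1)[of b ?m] bt ab K B[of "t + 1"] by (intro mult_left_mono) auto
              finally show ?thesis by (simp add: norm_minus_commute)
            qed
            also have "\<dots> \<le> C * (b - a + h ?m)"
              using C ab h[of ?m] by (intro mult_right_mono) auto
            also have "\<dots> \<le> C * (\<eta> + \<eta>)"
              using C ab elim by (intro mult_left_mono) auto
            also have "\<dots> \<le> 2 * \<delta> / 3" using \<eta>(3) by (simp add: algebra_simps)
            finally have "dist (Y ?m j) (y t) < \<delta>"
              using elim dist_triangle[of "Y ?m j" "y t" "z ?m t"] by (simp add: dist_norm z_def)
            moreover have "\<bar>t0 + real j * h ?m - t\<bar> < \<delta>"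
              using tj ab elim \<eta>' \<delta> by (auto simp: abs_less_iff)
            ultimately show "F (t0 + real j * h ?m) (euler F t0 (h ?m) y0 j) \<in> S"
              using h[of ?m] by (intro FS) (auto simp: Y_def)
          qed
        qed
        from Lim_in_closed_set[OF S(2) this sequentially_bot limQ] show ?thesis by simp
      qed
      have "(y s - y t) /\<^sub>R (s - t) \<in> S" if "s \<ge> t0" "s \<noteq> t" "\<bar>s - t\<bar> < \<eta>" for s
      proof (cases "s < t")
        case True
        have "(y s - y t) /\<^sub>R (s - t) = (y t - y s) /\<^sub>R (t - s)"
          by (metis minus_diff_eq scaleR_minus_left scaleR_minus_right inverse_minus_eq minus_minus)
        then show ?thesis using in_S[of s t] that True by simp
      next
        case False
        then show ?thesis using in_S[of t s] that t by simp
      qed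
      then show "\<exists>\<eta>>0. \<forall>s\<ge>t0. s \<noteq> t \<and> \<bar>s - t\<bar> < \<eta> \<longrightarrow> (y s - y t) /\<^sub>R (s - t) \<in> S"
        using \<eta>(1) by blast
    qed
  qed
qed

section \<open>The inertial gradient inclusion\<close>

lemma lipschitz_imp_abs_continuous_on:
  assumes L: "L-lipschitz_on {a..b} f"
  shows "abs_continuous_on a b f"
  unfolding abs_continuous_on_def
proof (intro allI impI)
  fix e :: real assume e: "e > 0"
  have L0: "L \<ge> 0" using lipschitz_on_nonneg[OF L] .
  show "\<exists>\<delta>>0. \<forall>(n::nat) s t.
       (\<forall>k<n. a \<le> s k \<and> s k \<le> t k \<and> t k \<le> b) \<and>
       (\<forall>k<n. \<forall>l<n. k \<noteq> l \<longrightarrow> t k \<le> s l \<or> t l \<le> s k) \<and>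
       (\<Sum>k<n. t k - s k) < \<delta> \<longrightarrow> (\<Sum>k<n. norm (f (t k) - f (s k))) < e"
  proof (intro exI conjI allI impI)
    \<comment> \<open>The summand 1 covers \<open>L = 0\<close>.\<close>
    show "e / (L + 1) > 0" using e L0 by simp
    fix n :: nat and s t :: "nat \<Rightarrow> real"
    assume st: "(\<forall>k<n. a \<le> s k \<and> s k \<le> t k \<and> t k \<le> b) \<and>
       (\<forall>k<n. \<forall>l<n. k \<noteq> l \<longrightarrow> t k \<le> s l \<or> t l \<le> s k) \<and>
       (\<Sum>k<n. t k - s k) < e / (L + 1)"
    have "(\<Sum>k<n. norm (f (t k) - f (s k))) \<le> (\<Sum>k<n. (L + 1) * (t k - s k))"
    proof (rule sum_mono)
      fix k assume "k \<in> {..<n}"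
      then have k: "a \<le> s k" "s k \<le> t k" "t k \<le> b" using st by auto
      have "norm (f (t k) - f (s k)) \<le> L * dist (t k) (s k)"
        unfolding dist_norm[symmetric] using k by (intro lipschitz_onD[OF L]) auto
      also have "\<dots> \<le> (L + 1) * (t k - s k)"
        using k by (auto simp: dist_real_def intro: mult_right_mono)
      finally show "norm (f (t k) - f (s k)) \<le> (L + 1) * (t k - s k)" .
    qed
    also have "\<dots> = (L + 1) * (\<Sum>k<n. t k - s k)" by (simp add: sum_distrib_left)
    also have "\<dots> < e" using st L0 by (simp add: field_simps)
    finally show "(\<Sum>k<n. norm (f (t k) - f (s k))) < e" .
  qed
qed

text \<open>The point of the translated set that comes from \<open>d\<close> is
  \<open>- (\<gamma> *\<^sub>R v)\<close>. Maximality of \<open>d\<close> in direction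
  \<open>v\<close> says that it forms a nonnegative inner product with every difference
  \<open>c - d\<close>, which is the variational characterisation of the point nearest to 0.\<close>

lemma closest_point_translated_face:
  fixes C :: "'a::euclidean_space set"
  assumes C: "convex C" "closed C" and d: "d \<in> C" "\<And>c. c \<in> C \<Longrightarrow> v \<bullet> c \<le> v \<bullet> d"
    and "\<gamma> \<ge> 0" and a: "a = - (\<gamma> *\<^sub>R v) - w - d"
  shows "\<gamma> *\<^sub>R v + closest_point ((\<lambda>c. c + w + a) ` C) 0 = 0"
proof -
  let ?S = "(\<lambda>c. c + w + a) ` C"
  have S: "?S = (+) (w + a) ` C" by (auto simp: algebra_simps)
  have "- (\<gamma> *\<^sub>R v) = closest_point ?S 0"
  proof (rule closest_point_unique)
    show "convex ?S" "closed ?S" unfolding S using C by (auto intro: convex_translation closed_translation)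
    show "- (\<gamma> *\<^sub>R v) \<in> ?S" using d(1) a by (intro image_eqI[of _ _ d]) (auto simp: algebra_simps)
    show "\<forall>y\<in>?S. dist 0 (- (\<gamma> *\<^sub>R v)) \<le> dist 0 y"
    proof (intro ballI)
      fix y assume "y \<in> ?S"
      then obtain c where c: "c \<in> C" "y = c + w + a" by blast
      define z where "z = - (\<gamma> *\<^sub>R v)"
      have y: "y = z + (c - d)" using c a by (simp add: z_def)
      have "z \<bullet> (c - d) = \<gamma> * (v \<bullet> d - v \<bullet> c)" by (simp add: z_def inner_diff_right algebra_simps)
      then have "z \<bullet> (c - d) \<ge> 0" using d(2)[OF c(1)] \<open>\<gamma> \<ge> 0\<close> by simp
      moreover have "norm (z + k) ^ 2 = norm z ^ 2 + 2 * (z \<bullet> k) + norm k ^ 2" for k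
        unfolding power2_norm_eq_inner by (simp add: inner_add_left inner_add_right inner_commute)
      ultimately have "norm z ^ 2 \<le> norm y ^ 2"
        unfolding y by simp
      then show "dist 0 (- (\<gamma> *\<^sub>R v)) \<le> dist 0 y"
        unfolding z_def[symmetric] using power2_le_imp_le[of "norm z" "norm y"] by simp
    qed
  qed
  from this[symmetric] show ?thesis by (simp only: add.right_inverse)
qed

text \<open>The convex hull of the active gradients is the face of \<open>Cset m g x\<close> on
  which the inner product with \<open>v\<close> is maximal.\<close>

definition active :: "nat \<Rightarrow> (nat \<Rightarrow> 'a::real_inner \<Rightarrow> 'a) \<Rightarrow> 'a \<Rightarrow> 'a \<Rightarrow> nat set" where
  "active m g x v = {i \<in> {1..m}. \<forall>j\<in>{1..m}. v \<bullet> g j x \<le> v \<bullet> g i x}"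

lemma active_face:
  assumes "d \<in> convex hull (\<lambda>i. g i x) ` active m g x v"
  shows "d \<in> Cset m g x" and "c \<in> Cset m g x \<Longrightarrow> v \<bullet> c \<le> v \<bullet> d"
proof -
  show "d \<in> Cset m g x"
    unfolding Cset_def by (rule subsetD[OF hull_mono assms]) (auto simp: active_def)
  assume c: "c \<in> Cset m g x"
  have hull: "convex hull (\<lambda>i. g i x) ` {1..m} \<subseteq> {c. v \<bullet> c \<le> v \<bullet> g i x}" if "i \<in> active m g x v" for i
    using that by (intro hull_minimal convex_halfspace_le) (auto simp: active_def)
  have "convex hull (\<lambda>i. g i x) ` active m g x v \<subseteq> {d. v \<bullet> d \<ge> v \<bullet> c}"
    using c hull by (intro hull_minimal convex_halfspace_ge) (auto simp: Cset_def)
  then show "v \<bullet> c \<le> v \<bullet> d" using assms by blast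
qed

text \<open>First-order form on pairs of position and velocity. The \<open>arg_min_on\<close> picks
  one active gradient, and this choice may jump with \<open>z\<close>.\<close>

definition field_selection ::
  "nat \<Rightarrow> (nat \<Rightarrow> 'a::real_inner \<Rightarrow> 'a) \<Rightarrow> (real \<Rightarrow> real) \<Rightarrow> (real \<Rightarrow> real) \<Rightarrow> real \<Rightarrow> 'a \<times> 'a \<Rightarrow> 'a \<times> 'a" where
  "field_selection m g \<gamma> \<omega> t z = (snd z, - (\<gamma> t *\<^sub>R snd z) - \<omega> t *\<^sub>R fst z
     - g (arg_min_on (\<lambda>i. - (snd z \<bullet> g i (fst z))) {1..m}) (fst z))"

section \<open>Linear growth and upper semicontinuity of the selection\<close>

lemma active_selection:
  assumes "m \<ge> (1::nat)"
  shows "arg_min_on (\<lambda>i. - (v \<bullet> g i x)) {1..m} \<in> active m g x v"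
  using arg_min_if_finite[of "{1..m}" "\<lambda>i. - (v \<bullet> g i x)"] assms
  by (auto simp: active_def not_less)

lemma field_selection_growth:
  fixes g :: "nat \<Rightarrow> 'a::euclidean_space \<Rightarrow> 'a"
  assumes m: "m \<ge> 1" and lip: "\<And>i. i \<in> {1..m} \<Longrightarrow> \<exists>L. L-lipschitz_on UNIV (g i)"
    and \<gamma>: "\<And>t. t \<ge> t0 \<Longrightarrow> \<bar>\<gamma> t\<bar> \<le> \<Gamma>" and \<omega>: "\<And>t. t \<ge> t0 \<Longrightarrow> \<bar>\<omega> t\<bar> \<le> \<Omega>"
  shows "\<exists>K. \<forall>t\<ge>t0. \<forall>z. norm (field_selection m g \<gamma> \<omega> t z) \<le> K * (1 + norm z)"
proof -
  obtain L where L: "\<And>i. i \<in> {1..m} \<Longrightarrow> (L i)-lipschitz_on UNIV (g i)"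
    using lip by metis
  \<comment> \<open>The sum serves as a common linear growth constant for all gradients.\<close>
  define G where "G = (\<Sum>i\<in>{1..m}. L i + norm (g i 0))"
  have L0: "0 \<le> L i" if "i \<in> {1..m}" for i
    using lipschitz_on_nonneg[OF L[OF that]] .
  have g: "norm (g i x) \<le> G * (1 + norm x)" if i: "i \<in> {1..m}" for i x
  proof -
    have "norm (g i x) \<le> norm (g i x - g i 0) + norm (g i 0)"
      by (rule norm_triangle_sub[of "g i x" "g i 0", unfolded add.commute[of "norm (g i 0)"]])
    also have "\<dots> \<le> L i * norm x + norm (g i 0)"
      using lipschitz_onD[OF L[OF i], of x 0] by (simp add: dist_norm)
    also have "\<dots> \<le> (L i + norm (g i 0)) * (1 + norm x)"
      using L0[OF i] by (simp add: algebra_simps)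
    also have "\<dots> \<le> G * (1 + norm x)"
      unfolding G_def using i L0 by (intro mult_right_mono member_le_sum) auto
    finally show ?thesis .
  qed
  have "norm (field_selection m g \<gamma> \<omega> t z) \<le> (1 + \<Gamma> + \<Omega> + G) * (1 + norm z)" if t: "t \<ge> t0" for t z
  proof -
    define i where "i = arg_min_on (\<lambda>i. - (snd z \<bullet> g i (fst z))) {1..m}"
    have i: "i \<in> {1..m}" using active_selection[OF m, of "snd z" g "fst z"] by (simp add: i_def active_def)
    have G0: "0 \<le> G" unfolding G_def using L0 by (intro sum_nonneg) auto
    have z: "norm (fst z) \<le> norm z" "norm (snd z) \<le> norm z"
      by (metis norm_fst_le norm_snd_le prod.collapse)+
    define A B C where "A = \<gamma> t *\<^sub>R snd z" and "B = \<omega> t *\<^sub>R fst z" and "C = g i (fst z)"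
    have A: "norm A \<le> \<Gamma> * norm z"
      unfolding A_def using \<gamma>[OF t] z by (auto intro!: mult_mono)
    have B: "norm B \<le> \<Omega> * norm z"
      unfolding B_def using \<omega>[OF t] z by (auto intro!: mult_mono)
    have C: "norm C \<le> G * (1 + norm z)"
      unfolding C_def using z G0
      by (intro order_trans[OF g[OF i, of "fst z"]] mult_left_mono) auto
    have "norm (field_selection m g \<gamma> \<omega> t z) \<le> norm (snd z) + norm (- A - B - C)"
      unfolding field_selection_def i_def A_def B_def C_def by (rule norm_Pair_le)
    moreover have "norm (- A - B - C) \<le> norm (- A - B) + norm C" "norm (- A - B) \<le> norm (- A) + norm B"
      by (rule norm_triangle_ineq4)+
    ultimately have "norm (field_selection m g \<gamma> \<omega> t z)
        \<le> norm z + (\<Gamma> * norm z + \<Omega> * norm z + G * (1 + norm z))"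
      using A B C z by simp
    also have "\<dots> \<le> (1 + \<Gamma> + \<Omega> + G) * (1 + norm z)"
      using \<gamma>[OF t] \<omega>[OF t] by (simp add: algebra_simps)
    finally show ?thesis .
  qed
  then show ?thesis by blast
qed

text \<open>Upper semicontinuity: an index inactive at \<open>(x, v)\<close> is strictly beaten by
  another one, and by continuity still is nearby. The index selected nearby is therefore active at
  \<open>(x, v)\<close>, and continuity of the remaining terms gives closeness.\<close>

lemma field_selection_near:
  fixes g :: "nat \<Rightarrow> 'a::euclidean_space \<Rightarrow> 'a"
  assumes m: "m \<ge> 1" and g: "\<And>i. i \<in> {1..m} \<Longrightarrow> continuous_on UNIV (g i)"
    and \<gamma>: "isCont \<gamma> t" and \<omega>: "isCont \<omega> t" and e: "e > 0"
  shows "\<exists>\<delta>>0. \<forall>s z. \<bar>s - t\<bar> < \<delta> \<longrightarrow> dist z (x, v) < \<delta> \<longrightarrow>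
        (\<exists>i\<in>active m g x v. dist (snd (field_selection m g \<gamma> \<omega> s z))
          (- (\<gamma> t *\<^sub>R v) - \<omega> t *\<^sub>R x - g i x) < e)"
proof -
  define H where "H i = (\<lambda>(s, z). - (\<gamma> s *\<^sub>R snd z) - \<omega> s *\<^sub>R fst z - g i (fst z))" for i
  define P where "P i y \<longleftrightarrow> dist (H i y) (H i (t, x, v)) < e \<and>
     (i \<in> active m g x v \<or> (\<exists>j\<in>{1..m}. snd (snd y) \<bullet> g i (fst (snd y)) < snd (snd y) \<bullet> g j (fst (snd y))))"
    for i and y :: "real \<times> 'a \<times> 'a"
  have ident: "((\<lambda>y. y) \<longlongrightarrow> (t, x, v)) (nhds (t, x, v))"
    by (rule filterlim_ident)
  have t: "((\<lambda>y. fst y) \<longlongrightarrow> t) (nhds (t, x, v))" and z: "((\<lambda>y. snd y) \<longlongrightarrow> (x, v)) (nhds (t, x, v))"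
    using tendsto_fst[OF ident] tendsto_snd[OF ident] by auto
  have x: "((\<lambda>y. fst (snd y)) \<longlongrightarrow> x) (nhds (t, x, v))" and v: "((\<lambda>y. snd (snd y)) \<longlongrightarrow> v) (nhds (t, x, v))"
    using tendsto_fst[OF z] tendsto_snd[OF z] by auto
  have gi: "((\<lambda>y. g i (fst (snd y))) \<longlongrightarrow> g i x) (nhds (t, x, v))" if "i \<in> {1..m}" for i
    using g[OF that] x by (intro isCont_tendsto_compose[of x "g i"]) (auto simp: continuous_on_eq_continuous_at)
  have "\<forall>\<^sub>F y in nhds (t, x, v). P i y" if i: "i \<in> {1..m}" for i
    unfolding P_def
  proof (rule eventually_conj)
    have "(H i \<longlongrightarrow> H i (t, x, v)) (nhds (t, x, v))"
      unfolding H_def case_prod_unfold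
      using isCont_tendsto_compose[OF \<gamma> t] isCont_tendsto_compose[OF \<omega> t] x v gi[OF i]
      by (auto intro!: tendsto_intros)
    then show "\<forall>\<^sub>F y in nhds (t, x, v). dist (H i y) (H i (t, x, v)) < e"
      using e by (rule tendstoD)
    show "\<forall>\<^sub>F y in nhds (t, x, v). i \<in> active m g x v \<or>
        (\<exists>j\<in>{1..m}. snd (snd y) \<bullet> g i (fst (snd y)) < snd (snd y) \<bullet> g j (fst (snd y)))"
    proof (cases "i \<in> active m g x v")
      case False
      then obtain j where j: "j \<in> {1..m}" "v \<bullet> g i x < v \<bullet> g j x"
        using i by (auto simp: active_def not_le)
      have "((\<lambda>y. snd (snd y) \<bullet> g j (fst (snd y)) - snd (snd y) \<bullet> g i (fst (snd y))) \<longlongrightarrow> v \<bullet> g j x - v \<bullet> g i x) (nhds (t, x, v))"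
        by (intro tendsto_intros v gi i j)
      from order_tendstoD(1)[OF this, of 0] j(2)
      have "\<forall>\<^sub>F y in nhds (t, x, v). 0 < snd (snd y) \<bullet> g j (fst (snd y)) - snd (snd y) \<bullet> g i (fst (snd y))"
        by simp
      then show ?thesis
        by eventually_elim (use j(1) in auto)
    qed simp
  qed
  then have "\<forall>\<^sub>F y in nhds (t, x, v). \<forall>i\<in>{1..m}. P i y"
    by (simp add: eventually_ball_finite)
  then obtain d where d: "d > 0" "\<And>y i. dist y (t, x, v) < d \<Longrightarrow> i \<in> {1..m} \<Longrightarrow> P i y"
    unfolding eventually_nhds_metric by blast
  show ?thesis
  proof (intro exI[of _ "d / 2"] conjI allI impI)
    show "d / 2 > 0" using d by simp
    fix s :: real and z :: "'a \<times> 'a" assume sz: "\<bar>s - t\<bar> < d / 2" "dist z (x, v) < d / 2"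
    define i where "i = arg_min_on (\<lambda>i. - (snd z \<bullet> g i (fst z))) {1..m}"
    have i: "i \<in> active m g (fst z) (snd z)" unfolding i_def by (rule active_selection[OF m])
    have "dist (s, z) (t, x, v) \<le> \<bar>s - t\<bar> + dist z (x, v)"
      using norm_Pair_le[of "s - t" "z - (x, v)"] by (simp add: dist_norm)
    then have "P i (s, z)" using sz i by (intro d(2)) (auto simp: active_def)
    \<comment> \<open>The selected index maximises at \<open>z\<close>, which rules out the second
      alternative in \<open>P\<close>.\<close>
    moreover have "\<not> (\<exists>j\<in>{1..m}. snd z \<bullet> g i (fst z) < snd z \<bullet> g j (fst z))"
      using i by (auto simp: active_def not_less)
    ultimately have "i \<in> active m g x v" "dist (H i (s, z)) (H i (t, x, v)) < e"
      by (auto simp: P_def)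
    then show "\<exists>i\<in>active m g x v. dist (snd (field_selection m g \<gamma> \<omega> s z))
          (- (\<gamma> t *\<^sub>R v) - \<omega> t *\<^sub>R x - g i x) < e"
      by (intro bexI[of _ i]) (simp_all add: field_selection_def H_def i_def)
  qed
qed

text \<open>The position component of the field is the velocity itself, which is continuous, so
  small balls around \<open>snd (y t)\<close> capture the quotients and the derivative exists at
  every time.\<close>

lemma limit_position_derivative:
  fixes y :: "real \<Rightarrow> 'a::euclidean_space \<times> 'a"
  assumes y: "krasovskii_at (field_selection m g \<gamma> \<omega>) t0 y t"
  shows "((\<lambda>t. fst (y t)) has_vector_derivative snd (y t)) (at t within {t0..})"
  unfolding has_vector_derivative_def has_derivative_within_alt
proof (intro conjI allI impI)
  show "bounded_linear (\<lambda>h. h *\<^sub>R snd (y t))" by (rule bounded_linear_scaleR_left)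
  fix e :: real assume e: "e > 0"
  obtain \<eta> where \<eta>: "\<eta> > 0"
    "\<And>s. s \<ge> t0 \<Longrightarrow> s \<noteq> t \<Longrightarrow> \<bar>s - t\<bar> < \<eta> \<Longrightarrow> (y s - y t) /\<^sub>R (s - t) \<in> cball (snd (y t)) e \<times> UNIV"
  proof -
    have "\<exists>\<eta>>0. \<forall>s\<ge>t0. s \<noteq> t \<and> \<bar>s - t\<bar> < \<eta> \<longrightarrow> (y s - y t) /\<^sub>R (s - t) \<in> cball (snd (y t)) e \<times> UNIV"
    proof (rule krasovskii_atD[OF y])
      show "convex (cball (snd (y t)) e \<times> (UNIV :: 'a set))" by (intro convex_Times convex_cball convex_UNIV)
      show "closed (cball (snd (y t)) e \<times> (UNIV :: 'a set))" by (intro closed_Times closed_cball closed_UNIV)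
      show "field_selection m g \<gamma> \<omega> s z \<in> cball (snd (y t)) e \<times> UNIV" if "dist z (y t) < e" for s z
        using dist_snd_le[of z "y t"] that by (auto simp: field_selection_def dist_commute)
    qed (rule e)
    then show thesis using that by blast
  qed
  have "norm (fst (y s) - fst (y t) - (s - t) *\<^sub>R snd (y t)) \<le> e * norm (s - t)"
    if s: "s \<in> {t0..}" "norm (s - t) < \<eta>" for s
  proof (cases "s = t")
    case False
    then have "norm ((fst (y s) - fst (y t)) /\<^sub>R (s - t) - snd (y t)) \<le> e"
      using \<eta>(2)[of s] s by (simp add: mem_Times_iff dist_norm norm_minus_commute)
    then have "norm (s - t) * norm ((fst (y s) - fst (y t)) /\<^sub>R (s - t) - snd (y t)) \<le> norm (s - t) * e"
      by (rule mult_left_mono) simp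
    also have "norm (s - t) * norm ((fst (y s) - fst (y t)) /\<^sub>R (s - t) - snd (y t))
        = norm (fst (y s) - fst (y t) - (s - t) *\<^sub>R snd (y t))"
      using False by (simp add: norm_scaleR[symmetric] scaleR_diff_right del: norm_scaleR)
    finally show ?thesis by (simp add: mult.commute)
  qed simp
  then show "\<exists>d>0. \<forall>s\<in>{t0..}. norm (s - t) < d \<longrightarrow>
      norm (fst (y s) - fst (y t) - (s - t) *\<^sub>R snd (y t)) \<le> e * norm (s - t)"
    using \<eta>(1) by blast
qed

text \<open>Field values near \<open>(t, y t)\<close> lie in the \<open>e\<close>-neighbourhood of
  the compact convex set \<open>D\<close> of admissible accelerations. Hence so do the quotients and
  their limit \<open>a\<close>; as \<open>e\<close> is arbitrary and \<open>D\<close> is closed,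
  \<open>a\<close> lies in \<open>D\<close>.\<close>

lemma limit_velocity_derivative:
  fixes y :: "real \<Rightarrow> 'a::euclidean_space \<times> 'a"
  assumes y: "krasovskii_at (field_selection m g \<gamma> \<omega>) t0 y t"
    and m: "m \<ge> 1" and g: "\<And>i. i \<in> {1..m} \<Longrightarrow> continuous_on UNIV (g i)"
    and cont: "isCont \<gamma> t" "isCont \<omega> t" and t: "t \<ge> t0"
    and a: "((\<lambda>t. snd (y t)) has_vector_derivative a) (at t)"
  shows "\<exists>d\<in>convex hull (\<lambda>i. g i (fst (y t))) ` active m g (fst (y t)) (snd (y t)).
           a = - (\<gamma> t *\<^sub>R snd (y t)) - \<omega> t *\<^sub>R fst (y t) - d"
proof -
  define x v where "x = fst (y t)" and "v = snd (y t)"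
  define w where "w = - (\<gamma> t *\<^sub>R v) - \<omega> t *\<^sub>R x"
  define C where "C = convex hull (\<lambda>i. g i x) ` active m g x v"
  define D where "D = (\<lambda>d. w - d) ` C"
  have "finite (active m g x v)" by (simp add: active_def)
  then have C: "convex C" "compact C"
    by (auto simp: C_def intro: finite_imp_compact_convex_hull)
  have D_eq: "D = (+) w ` uminus ` C" by (auto simp: D_def image_image)
  have D: "convex D" "compact D"
    unfolding D_eq using C
    by (auto intro!: convex_translation compact_translation convex_negations compact_negations)
  have "\<exists>d\<in>D. dist d a \<le> e" if e: "e > 0" for e
  proof -
    \<comment> \<open>Writing the neighbourhood as a Minkowski sum with a ball yields both convexity
      and closedness.\<close>
    define T where "T = (\<Union>d\<in>D. \<Union>b\<in>cball 0 e. {d + b})"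
    have T: "convex T" "closed T"
      unfolding T_def using D
      by (auto intro!: convex_sums compact_imp_closed compact_sums' compact_cball)
    have mem_T: "b \<in> T \<longleftrightarrow> (\<exists>d\<in>D. dist d b \<le> e)" for b
    proof
      assume "b \<in> T"
      then obtain d c where "d \<in> D" "norm c \<le> e" "b = d + c"
        unfolding T_def by auto
      then show "\<exists>d\<in>D. dist d b \<le> e"
        by (intro bexI[of _ d]) (simp_all add: dist_norm)
    next
      assume "\<exists>d\<in>D. dist d b \<le> e"
      then obtain d where "d \<in> D" "dist d b \<le> e" ..
      then show "b \<in> T"
        unfolding T_def by (intro UN_I[of d] UN_I[of "b - d"]) (simp_all add: dist_norm norm_minus_commute)
    qed
    obtain \<delta> where \<delta>: "\<delta> > 0"
      "\<And>s z. \<bar>s - t\<bar> < \<delta> \<Longrightarrow> dist z (x, v) < \<delta> \<Longrightarrow>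
        \<exists>i\<in>active m g x v. dist (snd (field_selection m g \<gamma> \<omega> s z))
          (- (\<gamma> t *\<^sub>R v) - \<omega> t *\<^sub>R x - g i x) < e"
      using field_selection_near[where g = g and x = x and v = v, OF m g cont e] by blast
    have "\<exists>\<eta>>0. \<forall>s\<ge>t0. s \<noteq> t \<and> \<bar>s - t\<bar> < \<eta> \<longrightarrow> (y s - y t) /\<^sub>R (s - t) \<in> UNIV \<times> T"
    proof (rule krasovskii_atD[OF y])
      show "convex ((UNIV :: 'a set) \<times> T)" "closed ((UNIV :: 'a set) \<times> T)"
        using T by (auto intro: convex_Times closed_Times)
      show "\<delta> > 0" by fact
      show "field_selection m g \<gamma> \<omega> s z \<in> UNIV \<times> T"
        if sz: "\<bar>s - t\<bar> < \<delta>" "dist z (y t) < \<delta>" for s z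
      proof -
        obtain i where i: "i \<in> active m g x v"
          "dist (snd (field_selection m g \<gamma> \<omega> s z)) (w - g i x) < e"
          using \<delta>(2)[of s z] sz unfolding w_def x_def v_def by auto
        have "w - g i x \<in> D"
          unfolding D_def C_def using i(1) by (intro imageI hull_inc) auto
        then have "snd (field_selection m g \<gamma> \<omega> s z) \<in> T"
          unfolding mem_T using i(2) by (auto simp: dist_commute intro!: bexI[of _ "w - g i x"])
        then show ?thesis by (simp add: mem_Times_iff)
      qed
    qed
    then obtain \<eta> where \<eta>: "\<eta> > 0"
      "\<And>s. s \<ge> t0 \<Longrightarrow> s \<noteq> t \<Longrightarrow> \<bar>s - t\<bar> < \<eta> \<Longrightarrow> snd ((y s - y t) /\<^sub>R (s - t)) \<in> T"
      by (auto simp: mem_Times_iff)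
    have "a \<in> T"
    proof (rule Lim_in_closed_set[OF T(2) _ _ has_vector_derivative_sequential_quotient[OF a]])
      have "(\<lambda>n. 1 / real (Suc n)) \<longlonglongrightarrow> 0"
        using LIMSEQ_inverse_real_of_nat by (simp add: inverse_eq_divide)
      from order_tendstoD(2)[OF this \<eta>(1)]
      show "\<forall>\<^sub>F n in sequentially. real (Suc n) *\<^sub>R (snd (y (t + 1 / real (Suc n))) - snd (y t)) \<in> T"
      proof eventually_elim
        case (elim n)
        then have "snd ((y (t + 1 / real (Suc n)) - y t) /\<^sub>R ((t + 1 / real (Suc n)) - t)) \<in> T"
          using t by (intro \<eta>(2)) (auto intro: add_increasing2 simp del: of_nat_Suc)
        then show ?case by (simp del: of_nat_Suc)
      qed
    qed simp
    then show ?thesis by (simp add: mem_T)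
  qed
  then have "\<exists>d\<in>D. dist d a < e" if "e > 0" for e
    using that by (meson dense le_less_trans)
  then have "a \<in> closure D" by (simp add: closure_approachable)
  then have "a \<in> D" using D(2) by (simp add: compact_imp_closed)
  then show ?thesis by (auto simp: D_def C_def w_def x_def v_def)
qed

theorem mainTheorem9:
  fixes m :: nat
    and f :: "nat \<Rightarrow> 'a::euclidean_space \<Rightarrow> real"
    and g :: "nat \<Rightarrow> 'a \<Rightarrow> 'a"
    and t0 \<alpha> \<beta> q p :: real
    and x0 v0 :: 'a
  assumes "m \<ge> 1"
    and "\<And>i. i \<in> {1..m} \<Longrightarrow> convex_on UNIV (f i)"
    and "\<And>i y. i \<in> {1..m} \<Longrightarrow> (f i has_derivative (\<lambda>h. g i y \<bullet> h)) (at y)"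
    and "\<And>i. i \<in> {1..m} \<Longrightarrow> continuous_on UNIV (g i)"
    and "\<And>i. i \<in> {1..m} \<Longrightarrow> \<exists>L. L-lipschitz_on UNIV (g i)"
    and "t0 > 0" and "\<alpha> > 0" and "\<beta> > 0"
    and "0 < q" and "q \<le> 1" and "0 < p" and "p \<le> 2"
  shows "\<exists>x. MTRIGS_solution m g \<alpha> \<beta> q p t0 x0 v0 x"
proof -
  define \<gamma> where "\<gamma> t = \<alpha> / t powr q" for t
  define \<omega> where "\<omega> t = \<beta> / t powr p" for t
  have cont: "isCont \<gamma> t" "isCont \<omega> t" if "t \<ge> t0" for t
    unfolding \<gamma>_def \<omega>_def using that \<open>t0 > 0\<close> by (auto intro!: continuous_intros)
  have \<gamma>: "\<bar>\<gamma> t\<bar> \<le> \<alpha> / t0 powr q" and \<omega>: "\<bar>\<omega> t\<bar> \<le> \<beta> / t0 powr p" if "t \<ge> t0" for t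
    unfolding \<gamma>_def \<omega>_def using that assms(6-12)
    by (auto simp: abs_mult intro!: divide_left_mono powr_mono2)
  obtain K where K: "\<And>t z. t \<ge> t0 \<Longrightarrow> norm (field_selection m g \<gamma> \<omega> t z) \<le> K * (1 + norm z)"
    using field_selection_growth[where g = g and \<gamma> = \<gamma> and \<omega> = \<omega>, OF assms(1,5) \<gamma> \<omega>] by blast
  obtain y where y0: "y t0 = (x0, v0)" and lip: "\<And>T. \<exists>L. L-lipschitz_on {t0..T} y"
    and y: "\<And>t. t \<ge> t0 \<Longrightarrow> krasovskii_at (field_selection m g \<gamma> \<omega>) t0 y t"
    using euler_polygons_limit[where ?t0.0 = t0 and ?y0.0 = "(x0, v0)" and F = "field_selection m g \<gamma> \<omega>", OF K]
    by blast
  define x v where "x t = fst (y t)" and "v t = snd (y t)" for t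
  have lipv: "\<exists>L. L-lipschitz_on {t0..T} v" for T
  proof -
    obtain L where L: "L-lipschitz_on {t0..T} y" using lip by blast
    have "L-lipschitz_on {t0..T} v"
    proof (rule lipschitz_onI)
      show "dist (v s) (v t) \<le> L * dist s t" if "s \<in> {t0..T}" "t \<in> {t0..T}" for s t
        unfolding v_def using dist_snd_le lipschitz_onD[OF L that] by (rule order_trans)
    qed (rule lipschitz_on_nonneg[OF L])
    then show ?thesis ..
  qed
  obtain a where a: "a \<in> borel_measurable borel"
    "\<And>t. t \<ge> t0 \<Longrightarrow> set_integrable lborel {t0..t} a"
    "\<And>t. t \<ge> t0 \<Longrightarrow> v t = v t0 + (LINT s:{t0..t}|lborel. a s)"
    "AE t in lborel. t0 < t \<longrightarrow> (v has_vector_derivative a t) (at t)"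
    using locally_lipschitz_integral_derivative[OF lipv] by blast
  have ae: "AE t in lborel. t \<ge> t0 \<longrightarrow> (v has_vector_derivative a t) (at t)"
    using a(4) AE_lborel_singleton[of t0] by eventually_elim auto
  \<comment> \<open>Wherever \<open>v\<close> has derivative \<open>a t\<close>, the inclusion
    supplies a point of the maximal face, and this turns into the projection equation.\<close>
  have proj: "(\<alpha> / t powr q) *\<^sub>R v t
      + closest_point ((\<lambda>c. c + (\<beta> / t powr p) *\<^sub>R x t + a t) ` Cset m g (x t)) 0 = 0"
    if t: "t \<ge> t0" and v': "(v has_vector_derivative a t) (at t)" for t
  proof -
    have "\<exists>d\<in>convex hull (\<lambda>i. g i (x t)) ` active m g (x t) (v t).
           a t = - (\<gamma> t *\<^sub>R v t) - \<omega> t *\<^sub>R x t - d"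
      unfolding x_def v_def
      by (rule limit_velocity_derivative[OF y[OF t] assms(1,4) cont[OF t] t v'[unfolded v_def]])
    then obtain d where d: "d \<in> convex hull (\<lambda>i. g i (x t)) ` active m g (x t) (v t)"
      "a t = - (\<gamma> t *\<^sub>R v t) - \<omega> t *\<^sub>R x t - d" by blast
    have "compact (Cset m g (x t))"
      unfolding Cset_def by (intro finite_imp_compact_convex_hull) simp
    then have "convex (Cset m g (x t))" "closed (Cset m g (x t))"
      by (auto simp: Cset_def compact_imp_closed)
    then show ?thesis
      using closest_point_translated_face[OF _ _ active_face[OF d(1)] _ d(2)] \<open>\<alpha> > 0\<close>
      by (simp add: \<gamma>_def \<omega>_def)
  qed
  have "MTRIGS_solution m g \<alpha> \<beta> q p t0 x0 v0 x"
    unfolding MTRIGS_solution_def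
  proof (rule exI[of _ v], rule exI[of _ a], intro conjI allI impI)
    show "(x has_vector_derivative v t) (at t within {t0..})" if "t \<ge> t0" for t
      unfolding x_def v_def by (rule limit_position_derivative[OF y[OF that]])
    show "continuous_on {t0..} v"
      unfolding continuous_on_eq_continuous_within
    proof
      fix t assume t: "t \<in> {t0..}"
      obtain L where "L-lipschitz_on {t0..t + 1} v" using lipv by blast
      then have "continuous (at t within {t0..t + 1}) v"
        using t by (auto dest!: lipschitz_on_continuous_on simp: continuous_on_eq_continuous_within)
      \<comment> \<open>The Lipschitz bound is available on compact intervals only; ending one
        beyond \<open>t\<close> leaves the filter at \<open>t\<close> unchanged.\<close>
      moreover have "at t within {t0..t + 1} = at t within {t0..}"
        by (rule at_within_nhd[of t "{..<t + 1}"]) (auto simp: open_lessThan)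
      ultimately show "continuous (at t within {t0..}) v" by (simp add: continuous_within)
    qed
    show "abs_continuous_on t0 T v" for T
      using lipv lipschitz_imp_abs_continuous_on by blast
    show "a \<in> borel_measurable (restrict_space lborel {t0..})"
      using a(1) by (intro measurable_restrict_space1) simp
    show "AE t in lborel. t \<ge> t0 \<longrightarrow> (v has_vector_derivative a t) (at t within {t0..})"
      using ae by eventually_elim (auto intro: has_vector_derivative_at_within)
    show "AE t in lborel. t \<ge> t0 \<longrightarrow> (\<alpha> / t powr q) *\<^sub>R v t
        + closest_point ((\<lambda>c. c + (\<beta> / t powr p) *\<^sub>R x t + a t) ` Cset m g (x t)) 0 = 0"
      using ae by eventually_elim (use proj in auto)
  qed (use a(2,3) y0 in \<open>auto simp: x_def v_def\<close>)
  then show ?thesis by (rule exI[of _ x])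
qed

end
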